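(* Let $0<q<1$ and $w\in\mathbb{C}\setminus\{0\}$. The spectral zeta-function $\zeta_{\mathcal{D}}(s)=\operatorname{Tr}|\mathcal{D}|^{-s}$ ($\Re(s)>0$) of the standard Podleś sphere admits a meromorphic continuation to the whole complex plane given by $$\zeta_{\mathcal{D}}(s)=4\Big(\frac{1-q^2}{|w|}\Big)^s\sum_{n=0}^\infty\frac{\Gamma(s+n)}{n!\,\Gamma(s)}\,\frac{q^{2n}}{(1-q^{s+2n})^2}.$$ All poles of $\zeta_{\mathcal{D}}$ are of the second order and they form the infinite countable set $$\mathrm{Sd}_1:=-2\mathbb{N}+i\,\frac{2\pi}{\log q}\,\mathbb{Z}\subset\mathbb{C}.$$
   Context: $\mathbb{N}=\{0,1,2,\dots\}$ and $[n]:=\frac{q^{-n}-q^n}{q^{-1}-q}$. Let $\mathcal{H}_{1/2}$ be the Hilbert space with orthonormal basis $|l,m\rangle$, $l\in\frac12+\mathbb{N}$, $m\in\{-l,-l+1,\dots,l\}$, and $\mathcal{H}=\mathcal{H}_{1/2}\oplus\mathcal{H}_{1/2}$. Let $D|l,m\rangle=[l+\frac12]|l,m\rangle$ and $\mathcal{D}=\begin{pmatrix}0&\bar wD\\ wD&0\end{pmatrix}$, so that $|\mathcal{D}|=|w|(D\oplus D)$. The quotient $\Gamma(s+n)/\Gamma(s)$ denotes the polynomial $s(s+1)\cdots(s+n-1)$ (equal to $1$ for $n=0$). *)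

theory Defs
  imports "HOL-Complex_Analysis.Complex_Analysis"
begin

section \<open>The Hilbert space with a prescribed orthonormal basis\<close>

text \<open>
  The Hilbert space with orthonormal basis labelled by \<open>I\<close> is modelled as \<open>\<ell>\<^sup>2(I)\<close>; a vector is the
  family of its coefficients, extended by zero outside \<open>I\<close>. The inner product is conjugate-linear
  in its first argument. The sums below range over the whole index type, which for vectors of
  \<open>ell2 I\<close> is the same as summing over \<open>I\<close>.
\<close>

definition ell2 :: "'i set \<Rightarrow> ('i \<Rightarrow> complex) set" where
  "ell2 I = {x. (\<forall>i. i \<notin> I \<longrightarrow> x i = 0) \<and> (\<lambda>i. (cmod (x i))\<^sup>2) summable_on I}"

definition ip :: "('i \<Rightarrow> complex) \<Rightarrow> ('i \<Rightarrow> complex) \<Rightarrow> complex" where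
  "ip x y = (\<Sum>\<^sub>\<infinity>i. cnj (x i) * y i)"

definition l2norm :: "('i \<Rightarrow> complex) \<Rightarrow> real" where
  "l2norm x = sqrt (\<Sum>\<^sub>\<infinity>i. (cmod (x i))\<^sup>2)"

definition orthonormal_basis :: "'i set \<Rightarrow> ('i \<Rightarrow> complex) set \<Rightarrow> bool" where
  "orthonormal_basis I B \<longleftrightarrow>
     B \<subseteq> ell2 I \<and>
     (\<forall>e\<in>B. \<forall>f\<in>B. ip e f = (if e = f then 1 else 0)) \<and>
     (\<forall>x\<in>ell2 I. \<forall>\<epsilon>>0. \<exists>F c. finite F \<and> F \<subseteq> B \<and> l2norm (\<lambda>i. x i - (\<Sum>e\<in>F. c e * e i)) < \<epsilon>)"

section \<open>Unbounded operators, given by their graphs\<close>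

type_synonym 'i graph = "(('i \<Rightarrow> complex) \<times> ('i \<Rightarrow> complex)) set"

definition adj :: "'i set \<Rightarrow> 'i graph \<Rightarrow> 'i graph" where
  "adj I T = {(y, z). y \<in> ell2 I \<and> z \<in> ell2 I \<and> (\<forall>(x, x')\<in>T. ip x' y = ip x z)}"

definition densely_defined :: "'i set \<Rightarrow> 'i graph \<Rightarrow> bool" where
  "densely_defined I T \<longleftrightarrow>
     (\<forall>x\<in>ell2 I. \<forall>\<epsilon>>0. \<exists>x'\<in>Domain T. l2norm (\<lambda>i. x i - x' i) < \<epsilon>)"

definition selfadjoint :: "'i set \<Rightarrow> 'i graph \<Rightarrow> bool" where
  "selfadjoint I T \<longleftrightarrow> densely_defined I T \<and> adj I T = T"

definition positive_op :: "'i graph \<Rightarrow> bool" where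
  "positive_op T \<longleftrightarrow> (\<forall>(x, y)\<in>T. ip x y \<in> \<real>\<^sub>\<ge>\<^sub>0)"

text \<open>
  \<open>|T|\<close> is the positive self-adjoint square root of \<open>T\<^sup>*T\<close>. Note that \<open>R O S\<close> is the relation which
  applies \<open>R\<close> first, so \<open>T O adj I T\<close> is the graph of \<open>T\<^sup>*T\<close> on its natural domain.
\<close>

definition modulus :: "'i set \<Rightarrow> 'i graph \<Rightarrow> 'i graph" where
  "modulus I T = (THE A. selfadjoint I A \<and> positive_op A \<and> A O A = T O adj I T)"

definition closed_linear_subspace :: "'i set \<Rightarrow> 'i graph \<Rightarrow> bool" where
  "closed_linear_subspace I M \<longleftrightarrow>
     M \<subseteq> ell2 I \<times> ell2 I \<and>
     (\<lambda>i. 0, \<lambda>i. 0) \<in> M \<and>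
     (\<forall>(x, y)\<in>M. \<forall>(x', y')\<in>M. (\<lambda>i. x i + x' i, \<lambda>i. y i + y' i) \<in> M) \<and>
     (\<forall>c. \<forall>(x, y)\<in>M. (\<lambda>i. c * x i, \<lambda>i. c * y i) \<in> M) \<and>
     (\<forall>x\<in>ell2 I. \<forall>y\<in>ell2 I.
        (\<forall>\<epsilon>>0. \<exists>(x', y')\<in>M. l2norm (\<lambda>i. x i - x' i) < \<epsilon> \<and> l2norm (\<lambda>i. y i - y' i) < \<epsilon>)
        \<longrightarrow> (x, y) \<in> M)"

text \<open>
  Functional calculus \<open>f(A)\<close> for a self-adjoint operator \<open>A\<close> whose eigenvectors span a dense
  subspace (pure point spectrum): the closed operator generated by
  \<open>f(A) v = f(\<mu>) v\<close> for all \<open>v\<close> with \<open>A v = \<mu> v\<close>.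
\<close>

definition functional_calculus :: "'i set \<Rightarrow> (real \<Rightarrow> complex) \<Rightarrow> 'i graph \<Rightarrow> 'i graph" where
  "functional_calculus I f A =
     \<Inter>{M. closed_linear_subspace I M \<and>
          (\<forall>v \<mu>. (v, \<lambda>i. of_real \<mu> * v i) \<in> A \<longrightarrow> (v, \<lambda>i. f \<mu> * v i) \<in> M)}"

definition op_powr :: "'i set \<Rightarrow> 'i graph \<Rightarrow> complex \<Rightarrow> 'i graph" where
  "op_powr I A z = functional_calculus I (\<lambda>t. of_real t powr z) A"

text \<open>
  For an operator \<open>T\<close>, being of trace class is the same as unconditional convergence of the diagonal
  sum in every orthonormal basis; the value is then independent of the basis.
\<close>

definition has_trace :: "'i set \<Rightarrow> 'i graph \<Rightarrow> complex \<Rightarrow> bool" where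
  "has_trace I T \<tau> \<longleftrightarrow>
     (\<forall>B. orthonormal_basis I B \<longrightarrow>
        B \<subseteq> Domain T \<and> ((\<lambda>e. ip e (THE y. (e, y) \<in> T)) has_sum \<tau>) B)"

section \<open>The Dirac operator of the standard Podles sphere\<close>

definition qnum :: "real \<Rightarrow> real \<Rightarrow> real" where
  "qnum q n = (q powr (- n) - q powr n) / (q powr (- 1) - q)"

definition labels :: "(real \<times> real) set" where
  "labels = {(l, m). \<exists>n k :: nat. l = 1 / 2 + of_nat n \<and> of_nat k \<le> 2 * l \<and> m = - l + of_nat k}"

text \<open>
  \<open>D |l,m\<rangle> = [l + 1/2] |l,m\<rangle>\<close> as a diagonal operator on its maximal (self-adjoint) domain.
\<close>

definition D_half :: "real \<Rightarrow> (real \<times> real) graph" where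
  "D_half q = {(x, y). x \<in> ell2 labels \<and> y \<in> ell2 labels \<and>
     (\<forall>(l, m)\<in>labels. y (l, m) = of_real (qnum q (l + 1 / 2)) * x (l, m))}"

text \<open>
  The direct sum of two copies of \<open>ell2 labels\<close> is \<open>ell2 (labels <+> labels)\<close>, the pair
  \<open>(x\<^sub>1, x\<^sub>2)\<close> being the family \<open>case_sum x\<^sub>1 x\<^sub>2\<close>.
\<close>

definition labels2 :: "(real \<times> real + real \<times> real) set" where
  "labels2 = labels <+> labels"

definition Dirac :: "real \<Rightarrow> complex \<Rightarrow> (real \<times> real + real \<times> real) graph" where
  "Dirac q w =
     {(case_sum x\<^sub>1 x\<^sub>2, case_sum (\<lambda>j. cnj w * y\<^sub>2 j) (\<lambda>j. w * y\<^sub>1 j)) | x\<^sub>1 x\<^sub>2 y\<^sub>1 y\<^sub>2.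
        (x\<^sub>1, y\<^sub>1) \<in> D_half q \<and> (x\<^sub>2, y\<^sub>2) \<in> D_half q}"

definition Sd1 :: "real \<Rightarrow> complex set" where
  "Sd1 q = {- 2 * of_nat k + \<i> * of_real (2 * pi / ln q) * of_int j | (k :: nat) (j :: int). True}"

end

theory Submission
  imports Defs
begin

text \<open>
  Any positive square root of \<open>\<D>\<^sup>*\<D>\<close> has the basis vectors as eigenvectors, so it is contained in a
  diagonal operator, and self-adjointness turns the inclusion into an equality. Hence \<open>|\<D>|\<close> is
  diagonal with eigenvalues \<open>|w| [N]\<close> of multiplicity \<open>4 N\<close> for \<open>N \<ge> 1\<close>, and by Parseval the trace in any
  orthonormal basis is \<open>\<zeta>(s) = 4 \<Sum> N (|w| [N])\<^bsup>-s\<^esup>\<close>. Writing \<open>[N] = q\<^bsup>1-N\<^esup> (1 - q\<^bsup>2N\<^esup>) / (1 - q\<^sup>2)\<close>, expanding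
  \<open>(1 - q\<^bsup>2N\<^esup>)\<^bsup>-s\<^esup>\<close> by the binomial series and summing over \<open>N\<close> first gives the stated series. Its tail
  from index \<open>n\<close> on converges locally uniformly for \<open>Re s > -2n\<close>, so near a point of real part \<open>-2k\<close>
  only the term of index \<open>k\<close> can be singular.
\<close>

section \<open>Square-summable families and diagonal operators\<close>

definition delta :: "'i \<Rightarrow> 'i \<Rightarrow> complex" where
  "delta i = (\<lambda>j. if j = i then 1 else 0)"

text \<open>Demanding \<open>y \<in> ell2 I\<close> gives multiplication by \<open>d\<close> its
  maximal domain; this makes it closed and, for real \<open>d\<close>, self-adjoint.\<close>

definition diag_op :: "'i set \<Rightarrow> ('i \<Rightarrow> complex) \<Rightarrow> 'i graph" where
  "diag_op I d = {(x, y). x \<in> ell2 I \<and> y \<in> ell2 I \<and> (\<forall>i\<in>I. y i = d i * x i)}"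

lemma ell2_outside: "x \<in> ell2 I \<Longrightarrow> i \<notin> I \<Longrightarrow> x i = 0"
  by (auto simp: ell2_def)

text \<open>Bridges the two conventions in use: membership sums over \<open>I\<close>, whereas
  \<open>ip\<close> and \<open>l2norm\<close> sum over the whole index type.\<close>

lemma ell2_iff_UNIV:
  "x \<in> ell2 I \<longleftrightarrow> (\<forall>i. i \<notin> I \<longrightarrow> x i = 0) \<and> (\<lambda>i. (cmod (x i))\<^sup>2) summable_on UNIV"
proof -
  have "(\<lambda>i. (cmod (x i))\<^sup>2) summable_on I \<longleftrightarrow> (\<lambda>i. (cmod (x i))\<^sup>2) summable_on UNIV"
    if "\<forall>i. i \<notin> I \<longrightarrow> x i = 0"
    by (rule summable_on_cong_neutral) (use that in auto)
  then show ?thesis by (auto simp: ell2_def)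
qed

lemma ell2_summable: "x \<in> ell2 I \<Longrightarrow> (\<lambda>i. (cmod (x i))\<^sup>2) summable_on UNIV"
  by (simp add: ell2_iff_UNIV)

text \<open>The common source of square-summability for scalings, truncations and bounded diagonal
  operators.\<close>

lemma ell2_dominated:
  assumes "x \<in> ell2 I" "\<And>i. i \<notin> I \<Longrightarrow> y i = 0" "\<And>i. i \<in> I \<Longrightarrow> cmod (y i) \<le> C * cmod (x i)"
  shows "y \<in> ell2 I"
proof -
  have "(\<lambda>i. (cmod (y i))\<^sup>2) summable_on I"
  proof (rule summable_on_comparison_test[where f = "\<lambda>i. C\<^sup>2 * (cmod (x i))\<^sup>2"])
    show "(\<lambda>i. C\<^sup>2 * (cmod (x i))\<^sup>2) summable_on I"
      using assms(1) by (intro summable_on_cmult_right) (simp add: ell2_def)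
    show "(cmod (y i))\<^sup>2 \<le> C\<^sup>2 * (cmod (x i))\<^sup>2" if "i \<in> I" for i
      using power_mono[OF assms(3)[OF that], of 2] by (simp add: power_mult_distrib)
  qed auto
  then show ?thesis using assms(2) by (auto simp: ell2_def)
qed

lemma ell2_cmult:
  assumes "x \<in> ell2 I"
  shows "(\<lambda>i. c * x i) \<in> ell2 I"
  by (rule ell2_dominated[OF assms, where C = "cmod c"])
    (simp_all add: ell2_outside[OF assms] norm_mult)

lemma ell2_zero: "(\<lambda>i. 0) \<in> ell2 I"
  by (simp add: ell2_def)

lemma cmod_add_squared_le: "(cmod (a + b))\<^sup>2 \<le> 2 * (cmod a)\<^sup>2 + 2 * (cmod b)\<^sup>2"
proof -
  have "(cmod (a + b))\<^sup>2 \<le> (cmod a + cmod b)\<^sup>2"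
    by (intro power_mono norm_triangle_ineq) auto
  also have "\<dots> \<le> 2 * (cmod a)\<^sup>2 + 2 * (cmod b)\<^sup>2"
    using zero_le_power2[of "cmod a - cmod b"] by (simp add: power2_eq_square algebra_simps)
  finally show ?thesis .
qed

lemma ell2_add:
  assumes "x \<in> ell2 I" "y \<in> ell2 I"
  shows "(\<lambda>i. x i + y i) \<in> ell2 I"
proof -
  have "(\<lambda>i. (cmod (x i + y i))\<^sup>2) summable_on I"
  proof (rule summable_on_comparison_test[where f = "\<lambda>i. 2 * (cmod (x i))\<^sup>2 + 2 * (cmod (y i))\<^sup>2"])
    show "(\<lambda>i. 2 * (cmod (x i))\<^sup>2 + 2 * (cmod (y i))\<^sup>2) summable_on I"
      using assms by (intro summable_on_add summable_on_cmult_right) (auto simp: ell2_def)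
  qed (auto intro: cmod_add_squared_le)
  then show ?thesis using assms by (auto simp: ell2_def)
qed

lemma ell2_diff:
  assumes "x \<in> ell2 I" "y \<in> ell2 I"
  shows "(\<lambda>i. x i - y i) \<in> ell2 I"
  using ell2_add[OF assms(1) ell2_cmult[OF assms(2), of "-1"]] by simp

lemma delta_ell2: "i \<in> I \<Longrightarrow> delta i \<in> ell2 I"
  unfolding ell2_def delta_def
  by (auto intro!: finite_nonzero_values_imp_summable_on finite_subset[of _ "{i}"] split: if_splits)

lemma ell2_finite_sum:
  assumes "finite F" "\<And>e. e \<in> F \<Longrightarrow> e \<in> ell2 I"
  shows "(\<lambda>i. \<Sum>e\<in>F. c e * e i) \<in> ell2 I"
  using assms
proof (induction F)
  case (insert e F)
  then have "(\<lambda>i. c e * e i + (\<Sum>e\<in>F. c e * e i)) \<in> ell2 I"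
    by (intro ell2_add ell2_cmult) auto
  with insert.hyps show ?case by simp
qed (simp add: ell2_zero)

section \<open>Inner product, norm and coordinates\<close>

lemma ip_summable:
  assumes "x \<in> ell2 I" "y \<in> ell2 I"
  shows "(\<lambda>i. cnj (x i) * y i) summable_on UNIV"
proof -
  have "(\<lambda>i. norm (cnj (x i) * y i)) summable_on UNIV"
  proof (rule summable_on_comparison_test[where f = "\<lambda>i. (cmod (x i))\<^sup>2 + (cmod (y i))\<^sup>2"])
    show "(\<lambda>i. (cmod (x i))\<^sup>2 + (cmod (y i))\<^sup>2) summable_on UNIV"
      using assms by (intro summable_on_add) (auto simp: ell2_summable)
    show "norm (cnj (x i) * y i) \<le> (cmod (x i))\<^sup>2 + (cmod (y i))\<^sup>2" for i
    proof -
      have "0 \<le> cmod (x i) * cmod (y i)" by simp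
      then show ?thesis
        using sum_squares_bound[of "cmod (x i)" "cmod (y i)"] unfolding norm_mult complex_mod_cnj
        by linarith
    qed
  qed auto
  then show ?thesis by (rule abs_summable_summable)
qed

lemma ip_add_right:
  assumes "x \<in> ell2 I" "y \<in> ell2 I" "z \<in> ell2 I"
  shows "ip x (\<lambda>i. y i + z i) = ip x y + ip x z"
  unfolding ip_def
  by (subst infsum_add[OF ip_summable ip_summable, symmetric])
    (use assms in \<open>auto simp: distrib_left\<close>)

lemma ip_cmult_right: "ip x (\<lambda>i. c * y i) = c * ip x y"
  unfolding ip_def by (subst infsum_cmult_right'[symmetric]) (simp add: algebra_simps)

lemma ip_cnj: "ip x y = cnj (ip y x)"
  unfolding ip_def by (subst infsum_cnj[symmetric]) (simp add: mult.commute)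

lemma ip_cmult_left: "ip (\<lambda>i. c * y i) x = cnj c * ip y x"
  by (metis complex_cnj_mult ip_cnj ip_cmult_right)

lemma ip_self:
  assumes "x \<in> ell2 I"
  shows "ip x x = of_real ((l2norm x)\<^sup>2)"
proof -
  have "0 \<le> (\<Sum>\<^sub>\<infinity>i. (cmod (x i))\<^sup>2)" by (rule infsum_nonneg) simp
  then have "(l2norm x)\<^sup>2 = (\<Sum>\<^sub>\<infinity>i. (cmod (x i))\<^sup>2)" by (simp add: l2norm_def)
  moreover have "((\<lambda>i. of_real ((cmod (x i))\<^sup>2) :: complex) has_sum
      of_real (\<Sum>\<^sub>\<infinity>i. (cmod (x i))\<^sup>2)) UNIV"
    by (intro has_sum_of_real has_sum_infsum ell2_summable[OF assms])
  moreover have "of_real ((cmod (x i))\<^sup>2) = cnj (x i) * x i" for i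
    by (metis complex_norm_square mult.commute)
  ultimately show ?thesis by (simp add: ip_def infsumI)
qed

lemma l2norm_nonneg: "0 \<le> l2norm x"
  by (simp add: l2norm_def infsum_nonneg)

lemma ip_delta_left: "ip (delta i) y = y i"
proof -
  have "ip (delta i) y = (\<Sum>\<^sub>\<infinity>j\<in>{i}. cnj (delta i j) * y j)"
    unfolding ip_def by (rule infsum_cong_neutral) (auto simp: delta_def)
  then show ?thesis by (simp add: delta_def)
qed

lemma ip_scaled_delta_left: "ip (\<lambda>j. c * delta i j) y = cnj c * y i"
  by (simp add: ip_cmult_left ip_delta_left)

text \<open>Coordinates are continuous: a single summand is at most the whole sum. Closedness of
  diagonal operators and definiteness of the norm rest on this.\<close>

lemma cmod_le_l2norm:
  assumes "x \<in> ell2 I"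
  shows "cmod (x i) \<le> l2norm x"
proof -
  have "(\<Sum>j\<in>{i}. (cmod (x j))\<^sup>2) \<le> (\<Sum>\<^sub>\<infinity>j. (cmod (x j))\<^sup>2)"
    by (rule finite_sum_le_infsum) (use assms in \<open>auto simp: ell2_summable\<close>)
  then have "(cmod (x i))\<^sup>2 \<le> (\<Sum>\<^sub>\<infinity>j. (cmod (x j))\<^sup>2)" by simp
  then show ?thesis unfolding l2norm_def by (rule real_le_rsqrt)
qed

lemma l2norm_eq_0: "x \<in> ell2 I \<Longrightarrow> l2norm x = 0 \<Longrightarrow> x = (\<lambda>i. 0)"
  using cmod_le_l2norm by (metis norm_le_zero_iff)

section \<open>Approximation by finite truncations\<close>

definition trunc :: "'i set \<Rightarrow> ('i \<Rightarrow> complex) \<Rightarrow> 'i \<Rightarrow> complex" where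
  "trunc F x = (\<lambda>i. if i \<in> F then x i else 0)"

lemma trunc_ell2: "x \<in> ell2 I \<Longrightarrow> trunc F x \<in> ell2 I"
  by (rule ell2_dominated[where C = 1]) (auto simp: trunc_def ell2_outside)

text \<open>One finite \<open>F\<close> has to serve both vectors, since graphs are approximated in
  both components at once.\<close>

lemma truncation_close:
  assumes x: "x \<in> ell2 I" and y: "y \<in> ell2 I" and "\<epsilon> > 0"
  obtains F where "finite F" "F \<subseteq> I"
    "l2norm (\<lambda>i. x i - trunc F x i) < \<epsilon>" "l2norm (\<lambda>i. y i - trunc F y i) < \<epsilon>"
proof -
  \<comment> \<open>\<open>g\<close> dominates both squared families, so one small tail of
    \<open>g\<close> controls both errors. Approximating to \<open>\<epsilon>\<^sup>2 / 2\<close>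
    keeps the tail strictly below \<open>\<epsilon>\<^sup>2\<close>.\<close>
  define g where "g i = (cmod (x i))\<^sup>2 + (cmod (y i))\<^sup>2" for i
  have g: "g summable_on UNIV" and gI: "g summable_on I"
    using x y unfolding g_def ell2_def
    by (auto intro!: summable_on_add simp: ell2_summable[OF x] ell2_summable[OF y])
  obtain F where F: "finite F" "F \<subseteq> I" "dist (sum g F) (infsum g I) \<le> \<epsilon>\<^sup>2 / 2"
    using infsum_finite_approximation[OF gI, of "\<epsilon>\<^sup>2 / 2"] \<open>\<epsilon> > 0\<close> by auto
  have "infsum g I = infsum g UNIV"
    by (rule infsum_cong_neutral) (use x y in \<open>auto simp: g_def ell2_outside\<close>)
  moreover have "infsum g UNIV = infsum g F + infsum g (- F)"
    using infsum_Un_disjoint[of g F "- F"] F(1) g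
    by (simp add: summable_on_subset_banach[OF g])
  ultimately have small: "infsum g (- F) < \<epsilon>\<^sup>2"
    using F(1,3) \<open>\<epsilon> > 0\<close> by (simp add: dist_real_def) (smt (verit) field_sum_of_halves zero_less_power)
  have bound: "l2norm (\<lambda>i. z i - trunc F z i) < \<epsilon>"
    if z: "z \<in> ell2 I" and le: "\<And>i. (cmod (z i))\<^sup>2 \<le> g i" for z
  proof -
    have "(\<Sum>\<^sub>\<infinity>i. (cmod (z i - trunc F z i))\<^sup>2) \<le> infsum g (- F)"
    proof (rule infsum_mono_neutral)
      show "(\<lambda>i. (cmod (z i - trunc F z i))\<^sup>2) summable_on UNIV"
        using ell2_diff[OF z trunc_ell2[OF z]] by (rule ell2_summable)
      show "g summable_on - F" by (rule summable_on_subset_banach[OF g]) simp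
    qed (use le in \<open>auto simp: trunc_def\<close>)
    with small have "l2norm (\<lambda>i. z i - trunc F z i) < sqrt (\<epsilon>\<^sup>2)"
      unfolding l2norm_def by (intro real_sqrt_less_mono) linarith
    then show ?thesis using \<open>\<epsilon> > 0\<close> by simp
  qed
  show ?thesis
    by (rule that[OF F(1,2)]) (rule bound, use x y in \<open>auto simp: g_def\<close>)+
qed

section \<open>Adjoints and functional calculus of diagonal operators\<close>

text \<open>The equation defining the adjoint is linear in \<open>(y, z)\<close>. For a self-adjoint
  \<open>A\<close>, given merely as a set of pairs, this is where linearity of \<open>A\<close>
  comes from.\<close>

lemma adj_linear:
  assumes T: "T \<subseteq> ell2 I \<times> ell2 I" and yz: "(y, z) \<in> adj I T" "(y', z') \<in> adj I T"
  shows "(\<lambda>i. y i + c * y' i, \<lambda>i. z i + c * z' i) \<in> adj I T"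
proof -
  have mem: "y \<in> ell2 I" "z \<in> ell2 I" "y' \<in> ell2 I" "z' \<in> ell2 I"
    using yz by (auto simp: adj_def)
  have "ip x' (\<lambda>i. y i + c * y' i) = ip x (\<lambda>i. z i + c * z' i)" if "(x, x') \<in> T" for x x'
  proof -
    have "x \<in> ell2 I" "x' \<in> ell2 I" "ip x' y = ip x z" "ip x' y' = ip x z'"
      using that T yz by (auto simp: adj_def)
    then show ?thesis
      using mem by (simp add: ip_add_right[of _ I] ell2_cmult ip_cmult_right)
  qed
  then show ?thesis
    using mem by (auto simp: adj_def ell2_add ell2_cmult)
qed

text \<open>The defining equations involve one coordinate at a time, and coordinates are continuous,
  so they survive limits.\<close>

lemma diag_op_closed_linear_subspace: "closed_linear_subspace I (diag_op I d)"
proof -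
  have "(x, y) \<in> diag_op I d"
    if x: "x \<in> ell2 I" and y: "y \<in> ell2 I"
      and close: "\<forall>\<epsilon>>0. \<exists>(x', y')\<in>diag_op I d. l2norm (\<lambda>i. x i - x' i) < \<epsilon> \<and> l2norm (\<lambda>i. y i - y' i) < \<epsilon>"
    for x y
  proof -
    have "y i = d i * x i" if "i \<in> I" for i
    proof -
      have "cmod (y i - d i * x i) \<le> 0 + e" if "e > 0" for e
      proof -
        \<comment> \<open>Chosen so that the final error
          \<open>\<epsilon> + cmod (d i) * \<epsilon>\<close> is exactly \<open>e\<close>.\<close>
        define \<epsilon> where "\<epsilon> = e / (1 + cmod (d i))"
        have "\<epsilon> > 0" unfolding \<epsilon>_def using that by (simp add: add_pos_nonneg)
        then obtain x' y' where xy: "(x', y') \<in> diag_op I d"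
          "l2norm (\<lambda>i. x i - x' i) < \<epsilon>" "l2norm (\<lambda>i. y i - y' i) < \<epsilon>"
          using close by blast
        have "cmod (x i - x' i) \<le> \<epsilon>" "cmod (y i - y' i) \<le> \<epsilon>"
          using cmod_le_l2norm[OF ell2_diff[OF x], of x' i] cmod_le_l2norm[OF ell2_diff[OF y], of y' i] xy
          by (auto simp: diag_op_def)
        moreover have "cmod (y i - d i * x i) = cmod ((y i - y' i) - d i * (x i - x' i))"
          using xy(1) \<open>i \<in> I\<close> by (auto simp: diag_op_def algebra_simps)
        ultimately have "cmod (y i - d i * x i) \<le> \<epsilon> + cmod (d i) * \<epsilon>"
          using norm_triangle_ineq4[of "y i - y' i" "d i * (x i - x' i)"]
            mult_left_mono[of "cmod (x i - x' i)" \<epsilon> "cmod (d i)", OF _ norm_ge_zero]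
          unfolding norm_mult by linarith
        also have "\<dots> = \<epsilon> * (1 + cmod (d i))" by (simp add: algebra_simps)
        also have "\<dots> = e"
          using add_pos_nonneg[OF zero_less_one norm_ge_zero[of "d i"]] by (simp add: \<epsilon>_def)
        finally show ?thesis by simp
      qed
      then have "cmod (y i - d i * x i) \<le> 0" by (rule field_le_epsilon)
      then show ?thesis by simp
    qed
    with x y show ?thesis by (simp add: diag_op_def)
  qed
  then show ?thesis
    unfolding closed_linear_subspace_def
    by (auto simp: diag_op_def ell2_zero algebra_simps intro: ell2_add ell2_cmult)
qed

lemma diag_op_delta: "i \<in> I \<Longrightarrow> (delta i, \<lambda>j. d i * delta i j) \<in> diag_op I d"
  by (auto simp: diag_op_def delta_ell2 ell2_cmult) (auto simp: delta_def)

text \<open>The right side is itself one of the intersected subspaces. Conversely, each such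
  subspace contains the graph over every basis vector, hence by linearity over finite truncations,
  hence by closedness all of the right side.\<close>

theorem functional_calculus_diag_op:
  "functional_calculus I f (diag_op I (\<lambda>i. of_real (d i))) = diag_op I (\<lambda>i. f (d i))" (is "?L = ?R")
proof
  \<comment> \<open>An eigenvector for \<open>\<mu>\<close> is supported on the indices with
    \<open>d i = \<mu>\<close>, where \<open>f \<mu>\<close> and \<open>f (d i)\<close>
    agree.\<close>
  have "(v, \<lambda>i. f \<mu> * v i) \<in> ?R"
    if "(v, \<lambda>i. of_real \<mu> * v i) \<in> diag_op I (\<lambda>i. of_real (d i))" for v \<mu>
    using that by (auto simp: diag_op_def ell2_cmult)
  then show "?L \<subseteq> ?R"
    unfolding functional_calculus_def using diag_op_closed_linear_subspace by blast
next
  have "(x, y) \<in> M"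
    if xy: "(x, y) \<in> ?R" and M: "closed_linear_subspace I M"
      and eig: "\<And>v \<mu>. (v, \<lambda>i. of_real \<mu> * v i) \<in> diag_op I (\<lambda>i. of_real (d i)) \<Longrightarrow> (v, \<lambda>i. f \<mu> * v i) \<in> M"
    for M x y
  proof -
    have add: "(\<lambda>i. u i + u' i, \<lambda>i. v i + v' i) \<in> M" if "(u, v) \<in> M" "(u', v') \<in> M" for u v u' v'
      using M that unfolding closed_linear_subspace_def by blast
    have scale: "(\<lambda>i. c * u i, \<lambda>i. c * v i) \<in> M" if "(u, v) \<in> M" for c u v
      using M that unfolding closed_linear_subspace_def by blast
    have x: "x \<in> ell2 I" and y: "y \<in> ell2 I" and yx: "\<And>i. i \<in> I \<Longrightarrow> y i = f (d i) * x i"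
      using xy by (auto simp: diag_op_def)
    have trunc: "(trunc F x, trunc F y) \<in> M" if "finite F" "F \<subseteq> I" for F
      using that
    proof (induction F)
      case empty
      then show ?case using M by (simp add: trunc_def closed_linear_subspace_def)
    next
      case (insert i F)
      have "(\<lambda>j. x i * delta i j, \<lambda>j. x i * (f (d i) * delta i j)) \<in> M"
        using insert.prems by (intro scale eig diag_op_delta) auto
      moreover have "(trunc F x, trunc F y) \<in> M" using insert by auto
      ultimately have "(\<lambda>j. x i * delta i j + trunc F x j,
          \<lambda>j. x i * (f (d i) * delta i j) + trunc F y j) \<in> M"
        by (rule add)
      moreover have "(\<lambda>j. x i * delta i j + trunc F x j) = trunc (insert i F) x"
        using insert.hyps by (auto simp: trunc_def delta_def)
      moreover have "(\<lambda>j. x i * (f (d i) * delta i j) + trunc F y j) = trunc (insert i F) y"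
        using insert.hyps insert.prems yx by (auto simp: trunc_def delta_def)
      ultimately show ?case by simp
    qed
    have "\<exists>(x', y')\<in>M. l2norm (\<lambda>i. x i - x' i) < \<epsilon> \<and> l2norm (\<lambda>i. y i - y' i) < \<epsilon>" if "\<epsilon> > 0" for \<epsilon>
    proof -
      obtain F where "finite F" "F \<subseteq> I"
        "l2norm (\<lambda>i. x i - trunc F x i) < \<epsilon>" "l2norm (\<lambda>i. y i - trunc F y i) < \<epsilon>"
        using truncation_close[OF x y \<open>\<epsilon> > 0\<close>] .
      then show ?thesis using trunc by (intro bexI[of _ "(trunc F x, trunc F y)"]) simp_all
    qed
    then show ?thesis
      using M x y unfolding closed_linear_subspace_def by blast
  qed
  then show "?R \<subseteq> ?L"
    unfolding functional_calculus_def by auto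
qed

text \<open>Finite truncations lie in the domain however fast \<open>d\<close> grows.\<close>

lemma densely_defined_diag_op: "densely_defined I (diag_op I d)"
  unfolding densely_defined_def
proof (intro ballI allI impI)
  fix x :: "'a \<Rightarrow> complex" and \<epsilon> :: real assume x: "x \<in> ell2 I" and "\<epsilon> > 0"
  then obtain F where F: "finite F" "F \<subseteq> I" "l2norm (\<lambda>i. x i - trunc F x i) < \<epsilon>"
    using truncation_close by metis
  have "(\<lambda>i. d i * trunc F x i) \<in> ell2 I"
    using F unfolding ell2_def trunc_def
    by (auto intro!: finite_nonzero_values_imp_summable_on finite_subset[of _ F] split: if_splits)
  then have "(trunc F x, \<lambda>i. d i * trunc F x i) \<in> diag_op I d"
    using trunc_ell2[OF x] by (auto simp: diag_op_def)
  then show "\<exists>x'\<in>Domain (diag_op I d). l2norm (\<lambda>i. x i - x' i) < \<epsilon>"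
    using F(3) by blast
qed

text \<open>Testing the adjoint relation against basis vectors reads off coordinates.
  \<open>T\<close> may be any graph containing these pairs, so the lemma also applies to an unknown
  square root.\<close>

lemma adj_subset_diag_op:
  assumes "\<And>i. i \<in> I \<Longrightarrow> (delta i, \<lambda>j. d i * delta i j) \<in> T"
  shows "adj I T \<subseteq> diag_op I (\<lambda>i. cnj (d i))"
proof (clarify)
  fix y z assume "(y, z) \<in> adj I T"
  then have "y \<in> ell2 I" "z \<in> ell2 I" and eq: "\<And>x x'. (x, x') \<in> T \<Longrightarrow> ip x' y = ip x z"
    by (auto simp: adj_def)
  moreover have "z i = cnj (d i) * y i" if "i \<in> I" for i
    using eq[OF assms[OF that]] by (simp add: ip_delta_left ip_scaled_delta_left)
  ultimately show "(y, z) \<in> diag_op I (\<lambda>i. cnj (d i))" by (simp add: diag_op_def)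
qed

lemma adj_diag_op: "adj I (diag_op I d) = diag_op I (\<lambda>i. cnj (d i))"
proof
  show "adj I (diag_op I d) \<subseteq> diag_op I (\<lambda>i. cnj (d i))"
    by (intro adj_subset_diag_op diag_op_delta)
  have "ip x' y = ip x z" if "(x, x') \<in> diag_op I d" "(y, z) \<in> diag_op I (\<lambda>i. cnj (d i))" for x x' y z
    unfolding ip_def
  proof (rule infsum_cong)
    fix i show "cnj (x' i) * y i = cnj (x i) * z i"
      using that by (cases "i \<in> I") (auto simp: diag_op_def ell2_outside)
  qed
  then show "diag_op I (\<lambda>i. cnj (d i)) \<subseteq> adj I (diag_op I d)"
    by (auto simp: adj_def diag_op_def)
qed

lemma selfadjoint_diag_op: "selfadjoint I (diag_op I (\<lambda>i. of_real (d i)))"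
  by (simp add: selfadjoint_def densely_defined_diag_op adj_diag_op)

lemma positive_diag_op:
  assumes "\<And>i. i \<in> I \<Longrightarrow> 0 \<le> d i"
  shows "positive_op (diag_op I (\<lambda>i. of_real (d i)))"
  unfolding positive_op_def
proof clarify
  fix x y assume xy: "(x, y) \<in> diag_op I (\<lambda>i. of_real (d i))"
  then have eq: "cnj (x i) * y i = of_real (if i \<in> I then d i * (cmod (x i))\<^sup>2 else 0)" for i
    using complex_norm_square[of "x i"]
    by (cases "i \<in> I") (auto simp: diag_op_def ell2_outside mult_ac)
  have "0 \<le> ip x y"
    unfolding ip_def
  proof (rule infsum_nonneg_complex)
    show "(\<lambda>i. cnj (x i) * y i) summable_on UNIV"
      using xy by (intro ip_summable[of _ I]) (auto simp: diag_op_def)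
  qed (use assms in \<open>auto simp: eq less_eq_complex_def\<close>)
  then show "ip x y \<in> \<real>\<^sub>\<ge>\<^sub>0"
    by (simp add: complex_nonneg_Reals_iff less_eq_complex_def)
qed

section \<open>Uniqueness of the positive square root\<close>

text \<open>If \<open>A\<^sup>2 e = \<mu>\<^sup>2 e\<close>, then \<open>f = A e - \<mu> e\<close> satisfies \<open>A f = - \<mu> f\<close>, so that positivity
  of \<open>A\<close> forces \<open>f = 0\<close>.\<close>

lemma positive_sqrt_eigenvector:
  assumes A: "selfadjoint I A" "positive_op A" and "\<mu> > 0"
    and e: "(e, \<lambda>i. of_real (\<mu>\<^sup>2) * e i) \<in> A O A"
  shows "(e, \<lambda>i. of_real \<mu> * e i) \<in> A"
proof -
  have adj: "adj I A = A" and sub: "A \<subseteq> ell2 I \<times> ell2 I"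
    using A(1) by (auto simp: selfadjoint_def adj_def)
  have comb: "(\<lambda>i. y i + c * y' i, \<lambda>i. z i + c * z' i) \<in> A"
    if "(y, z) \<in> A" "(y', z') \<in> A" for y z y' z' c
    using adj_linear[OF sub] that unfolding adj by blast
  obtain u where u: "(e, u) \<in> A" "(u, \<lambda>i. of_real (\<mu>\<^sup>2) * e i) \<in> A" using e by auto
  define f where "f = (\<lambda>i. u i + (- of_real \<mu>) * e i)"
  have f: "f \<in> ell2 I" using u sub ell2_add ell2_cmult unfolding f_def by blast
  have "(f, \<lambda>i. of_real (\<mu>\<^sup>2) * e i + (- of_real \<mu>) * u i) \<in> A"
    unfolding f_def using u by (intro comb)
  moreover have "(\<lambda>i. of_real (\<mu>\<^sup>2) * e i + (- of_real \<mu>) * u i) = (\<lambda>i. (- of_real \<mu>) * f i)"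
    by (auto simp: f_def algebra_simps power2_eq_square)
  ultimately have "ip f (\<lambda>i. (- of_real \<mu>) * f i) \<in> \<real>\<^sub>\<ge>\<^sub>0"
    using A(2) by (auto simp: positive_op_def)
  then have "of_real (- \<mu> * (l2norm f)\<^sup>2) \<in> (\<real>\<^sub>\<ge>\<^sub>0 :: complex set)"
    unfolding ip_cmult_right ip_self[OF f] by (simp only: of_real_mult of_real_minus)
  then have "\<mu> * (l2norm f)\<^sup>2 \<le> 0"
    by (simp only: nonneg_Reals_of_real_iff)
  then have "l2norm f = 0"
    using \<open>\<mu> > 0\<close> by (simp add: mult_le_0_iff)
  then have "u = (\<lambda>i. of_real \<mu> * e i)"
    using l2norm_eq_0[OF f] by (simp add: f_def fun_eq_iff)
  then show ?thesis using u by simp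
qed

theorem modulus_eq_diag_op:
  assumes pos: "\<And>i. i \<in> I \<Longrightarrow> 0 < d i"
    and sq: "T O adj I T = diag_op I (\<lambda>i. of_real (d i)) O diag_op I (\<lambda>i. of_real (d i))"
  shows "modulus I T = diag_op I (\<lambda>i. of_real (d i))" (is "_ = ?D")
  unfolding modulus_def sq
proof (rule the_equality)
  show "selfadjoint I ?D \<and> positive_op ?D \<and> ?D O ?D = ?D O ?D"
    using pos by (auto intro!: selfadjoint_diag_op positive_diag_op less_imp_le)
next
  fix A assume A: "selfadjoint I A \<and> positive_op A \<and> A O A = ?D O ?D"
  then have adj: "adj I A = A" by (simp add: selfadjoint_def)
  have "(delta i, \<lambda>j. of_real (d i) * delta i j) \<in> A" if i: "i \<in> I" for i
  proof (rule positive_sqrt_eigenvector)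
    have "(\<lambda>j. of_real (d i) * delta i j, \<lambda>j. of_real ((d i)\<^sup>2) * delta i j) \<in> ?D"
      using i by (auto simp: diag_op_def delta_ell2 ell2_cmult power2_eq_square) (auto simp: delta_def)
    with diag_op_delta[OF i, of "\<lambda>i. of_real (d i)"]
    show "(delta i, \<lambda>j. of_real ((d i)\<^sup>2) * delta i j) \<in> A O A" using A by blast
  qed (use A pos[OF i] in auto)
  then have AD: "A \<subseteq> ?D"
    using adj_subset_diag_op[of I "\<lambda>i. of_real (d i)" A] by (simp add: adj)
  \<comment> \<open>Adjoints reverse inclusions. Both operators equal their adjoints, so this is the
    opposite inclusion.\<close>
  then have "adj I ?D \<subseteq> adj I A"
    by (auto simp: adj_def)
  with AD show "A = ?D" by (simp add: adj adj_diag_op)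
qed

section \<open>Parseval and traces\<close>

lemma ip_diff_right:
  assumes "x \<in> ell2 I" "y \<in> ell2 I" "z \<in> ell2 I"
  shows "ip x (\<lambda>i. y i - z i) = ip x y - ip x z"
  using ip_add_right[OF assms(1,2) ell2_cmult[OF assms(3), of "-1"]]
    ip_cmult_right[of x "-1" z] by simp

lemma ip_diff_left:
  assumes "x \<in> ell2 I" "y \<in> ell2 I" "z \<in> ell2 I"
  shows "ip (\<lambda>i. y i - z i) x = ip y x - ip z x"
  using ip_diff_right[OF assms] by (metis complex_cnj_diff ip_cnj)

lemma ip_finite_sum_right:
  assumes "finite F" "x \<in> ell2 I" "\<And>e. e \<in> F \<Longrightarrow> e \<in> ell2 I"
  shows "ip x (\<lambda>i. \<Sum>e\<in>F. c e * e i) = (\<Sum>e\<in>F. c e * ip x e)"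
  using assms
proof (induction F)
  case empty
  then show ?case by (simp add: ip_def)
next
  case (insert e F)
  then show ?case
    by (simp add: ip_add_right[of x I] ell2_cmult ell2_finite_sum ip_cmult_right)
qed

text \<open>Pythagoras with arbitrary coefficients; the last sum measures their distance from the
  Fourier coefficients. Taking the latter yields Bessel's inequality, and arbitrary \<open>c\<close>
  is what the density condition supplies.\<close>

lemma l2norm_diff_orthonormal:
  assumes "finite F" "x \<in> ell2 I" "\<And>e. e \<in> F \<Longrightarrow> e \<in> ell2 I"
    and "\<And>e f. e \<in> F \<Longrightarrow> f \<in> F \<Longrightarrow> ip e f = (if e = f then 1 else 0)"
  shows "(l2norm (\<lambda>i. x i - (\<Sum>e\<in>F. c e * e i)))\<^sup>2 =
    (l2norm x)\<^sup>2 - (\<Sum>e\<in>F. (cmod (ip e x))\<^sup>2) + (\<Sum>e\<in>F. (cmod (c e - ip e x))\<^sup>2)"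
  using assms
proof (induction F)
  case empty
  then show ?case by simp
next
  case (insert e F)
  define r where "r = (\<lambda>i. x i - (\<Sum>e\<in>F. c e * e i))"
  have e: "e \<in> ell2 I" and ee: "ip e e = 1" using insert.prems by auto
  have r: "r \<in> ell2 I"
    unfolding r_def using insert by (intro ell2_diff ell2_finite_sum) auto
  have "ip e r = ip e x - (\<Sum>f\<in>F. c f * ip e f)"
    unfolding r_def using insert e
    by (simp add: ip_diff_right[of e I] ell2_finite_sum ip_finite_sum_right[of F e I])
  \<comment> \<open>\<open>e\<close> is orthogonal to every earlier vector, so removing those leaves
    its Fourier coefficient unchanged.\<close>
  also have "(\<Sum>f\<in>F. c f * ip e f) = 0"
    using insert by (intro sum.neutral) auto
  finally have er: "ip e r = ip e x" by simp
  have "complex_of_real ((l2norm (\<lambda>i. r i - c e * e i))\<^sup>2) = ip (\<lambda>i. r i - c e * e i) (\<lambda>i. r i - c e * e i)"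
    by (rule ip_self[of _ I, symmetric]) (intro ell2_diff ell2_cmult r e)
  also have "\<dots> = ip r r - cnj (c e) * ip e r - (c e * ip r e - c e * cnj (c e) * ip e e)"
    using r e by (simp add: ip_diff_right[of _ I] ip_diff_left[of _ I] ell2_diff ell2_cmult
        ip_cmult_left ip_cmult_right algebra_simps)
  also have "ip r e = cnj (ip e x)" using er ip_cnj by metis
  \<comment> \<open>Completing the square in \<open>c e\<close> around
    \<open>ip e x\<close>.\<close>
  also have "ip r r - cnj (c e) * ip e r - (c e * cnj (ip e x) - c e * cnj (c e) * ip e e) =
      of_real ((l2norm r)\<^sup>2 - (cmod (ip e x))\<^sup>2 + (cmod (c e - ip e x))\<^sup>2)"
    unfolding er ee ip_self[OF r] of_real_add of_real_diff complex_norm_square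
    by (simp add: algebra_simps)
  finally have step: "(l2norm (\<lambda>i. r i - c e * e i))\<^sup>2 =
      (l2norm r)\<^sup>2 - (cmod (ip e x))\<^sup>2 + (cmod (c e - ip e x))\<^sup>2"
    by (simp only: of_real_eq_iff)
  have split: "(\<lambda>i. x i - (\<Sum>e\<in>insert e F. c e * e i)) = (\<lambda>i. r i - c e * e i)"
    using insert.hyps by (auto simp: r_def)
  have IH: "(l2norm r)\<^sup>2 =
    (l2norm x)\<^sup>2 - (\<Sum>e\<in>F. (cmod (ip e x))\<^sup>2) + (\<Sum>e\<in>F. (cmod (c e - ip e x))\<^sup>2)"
    unfolding r_def by (rule insert.IH) (use insert.prems in blast)+
  show ?case unfolding split unfolding step IH sum.insert[OF insert.hyps] by simp
qed

text \<open>Bessel's inequality bounds the sum from above. For the lower bound, an approximation of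
  squared error at most \<open>\<epsilon>\<close> can only improve when its coefficients are
  replaced by Fourier coefficients.\<close>

theorem parseval:
  assumes B: "orthonormal_basis I B" and x: "x \<in> ell2 I"
  shows "((\<lambda>e. (cmod (ip e x))\<^sup>2) has_sum (l2norm x)\<^sup>2) B"
proof -
  have ell2: "\<And>e. e \<in> B \<Longrightarrow> e \<in> ell2 I"
    and on: "\<And>e f. e \<in> B \<Longrightarrow> f \<in> B \<Longrightarrow> ip e f = (if e = f then 1 else 0)"
    and dense: "\<And>\<epsilon>. \<epsilon> > 0 \<Longrightarrow>
      \<exists>F c. finite F \<and> F \<subseteq> B \<and> l2norm (\<lambda>i. x i - (\<Sum>e\<in>F. c e * e i)) < \<epsilon>"
    using B x unfolding orthonormal_basis_def by blast+
  have bessel: "(\<Sum>e\<in>F. (cmod (ip e x))\<^sup>2) \<le> (l2norm x)\<^sup>2" if "finite F" "F \<subseteq> B" for F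
  proof -
    have "(l2norm (\<lambda>i. x i - (\<Sum>e\<in>F. ip e x * e i)))\<^sup>2 =
        (l2norm x)\<^sup>2 - (\<Sum>e\<in>F. (cmod (ip e x))\<^sup>2) + (\<Sum>e\<in>F. (cmod (ip e x - ip e x))\<^sup>2)"
      using that(1) x by (rule l2norm_diff_orthonormal) (use that(2) ell2 on in blast)+
    also have "(\<Sum>e\<in>F. (cmod (ip e x - ip e x))\<^sup>2) = 0" by simp
    finally show ?thesis using zero_le_power2 by (smt (verit))
  qed
  then have summable: "(\<lambda>e. (cmod (ip e x))\<^sup>2) summable_on B"
    by (intro nonneg_bounded_partial_sums_imp_summable_on[where C = "(l2norm x)\<^sup>2"]
        eventually_finite_subsets_at_top_weakI) auto
  have "infsum (\<lambda>e. (cmod (ip e x))\<^sup>2) B = (l2norm x)\<^sup>2"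
  proof (rule antisym)
    show "infsum (\<lambda>e. (cmod (ip e x))\<^sup>2) B \<le> (l2norm x)\<^sup>2"
      using summable bessel by (rule infsum_le_finite_sums)
    show "(l2norm x)\<^sup>2 \<le> infsum (\<lambda>e. (cmod (ip e x))\<^sup>2) B"
    proof (rule field_le_epsilon)
      fix \<epsilon> :: real assume "\<epsilon> > 0"
      then obtain F c where F: "finite F" "F \<subseteq> B"
        and small: "l2norm (\<lambda>i. x i - (\<Sum>e\<in>F. c e * e i)) < sqrt \<epsilon>"
        using dense[of "sqrt \<epsilon>"] by auto
      have "(l2norm (\<lambda>i. x i - (\<Sum>e\<in>F. c e * e i)))\<^sup>2 \<le> \<epsilon>"
        using power_mono[OF less_imp_le[OF small] l2norm_nonneg, of 2] \<open>\<epsilon> > 0\<close> by simp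
      moreover have "(l2norm (\<lambda>i. x i - (\<Sum>e\<in>F. c e * e i)))\<^sup>2 =
          (l2norm x)\<^sup>2 - (\<Sum>e\<in>F. (cmod (ip e x))\<^sup>2) + (\<Sum>e\<in>F. (cmod (c e - ip e x))\<^sup>2)"
        using F(1) x
        by (rule l2norm_diff_orthonormal) (use F(2) ell2 on in blast)+
      moreover have "0 \<le> (\<Sum>e\<in>F. (cmod (c e - ip e x))\<^sup>2)" by (intro sum_nonneg) auto
      moreover have "(\<Sum>e\<in>F. (cmod (ip e x))\<^sup>2) \<le> infsum (\<lambda>e. (cmod (ip e x))\<^sup>2) B"
        using F summable by (intro finite_sum_le_infsum) auto
      ultimately show "(l2norm x)\<^sup>2 \<le> infsum (\<lambda>e. (cmod (ip e x))\<^sup>2) B + \<epsilon>" by linarith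
    qed
  qed
  with summable show ?thesis by (simp add: has_sum_iff)
qed

text \<open>Parseval for \<open>delta i\<close>: the columns of the change of basis have unit
  length.\<close>

lemma orthonormal_basis_column_sum:
  assumes "orthonormal_basis I B" "i \<in> I"
  shows "((\<lambda>e. (cmod (e i))\<^sup>2) has_sum 1) B"
proof -
  have "ip (delta i) (delta i) = 1" unfolding ip_delta_left by (simp add: delta_def)
  then have "(l2norm (delta i))\<^sup>2 = 1"
    using ip_self[OF delta_ell2[OF assms(2)]] by (simp flip: of_real_eq_iff[where 'a = complex])
  moreover have "cmod (ip e (delta i)) = cmod (e i)" for e
    by (metis complex_mod_cnj ip_cnj ip_delta_left)
  ultimately show ?thesis
    using parseval[OF assms(1) delta_ell2[OF assms(2)]] by simp
qed

text \<open>Fubini for the family \<open>d i * (cmod (e i))\<^sup>2\<close> over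
  \<open>I \<times> B\<close>. Summing over \<open>B\<close> first gives \<open>d i\<close> by the
  unit columns; summing over \<open>I\<close> first gives the diagonal entry at
  \<open>e\<close>.\<close>

theorem has_trace_diag_op:
  assumes d: "(d has_sum \<tau>) I"
  shows "has_trace I (diag_op I d) \<tau>"
  unfolding has_trace_def
proof (intro allI impI conjI)
  fix B assume B: "orthonormal_basis I B"
  then have BI: "B \<subseteq> ell2 I" by (simp add: orthonormal_basis_def)
  \<comment> \<open>For complex families, unconditional and absolute summability coincide.\<close>
  have abs: "(\<lambda>i. cmod (d i)) summable_on I"
    using d by (simp add: summable_on_iff_abs_summable_on_complex[symmetric] has_sum_iff)
  \<comment> \<open>\<open>S\<close> bounds every \<open>d i\<close>, so the operator is bounded and
    defined on all of \<open>ell2 I\<close>.\<close>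
  define S where "S = infsum (\<lambda>i. cmod (d i)) I"
  have bound: "cmod (d i) \<le> S" if "i \<in> I" for i
    using finite_sum_le_infsum[OF abs, of "{i}"] that by (simp add: S_def)
  define De where "De e = (\<lambda>i. if i \<in> I then d i * e i else 0)" for e :: "'a \<Rightarrow> complex"
  have graph: "(e, De e) \<in> diag_op I d" if "e \<in> ell2 I" for e
  proof -
    have "De e \<in> ell2 I"
      using bound by (intro ell2_dominated[OF that, where C = S])
        (auto simp: De_def norm_mult intro: mult_right_mono)
    with that show ?thesis by (auto simp: diag_op_def De_def)
  qed
  then show "B \<subseteq> Domain (diag_op I d)" using BI by blast
  have val: "ip e (THE y. (e, y) \<in> diag_op I d) = (\<Sum>\<^sub>\<infinity>i\<in>I. d i * of_real ((cmod (e i))\<^sup>2))"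
    if "e \<in> B" for e
  proof -
    have "e \<in> ell2 I" using that BI by blast
    \<comment> \<open>The image is unique: it is prescribed on \<open>I\<close>, and members of
      \<open>ell2 I\<close> vanish elsewhere.\<close>
    then have "(THE y. (e, y) \<in> diag_op I d) = De e"
      by (intro the_equality graph) (auto simp: diag_op_def De_def fun_eq_iff ell2_outside)
    then show ?thesis
      unfolding ip_def complex_norm_square
      by (intro infsum_cong_neutral) (auto simp: De_def mult_ac)
  qed
  have col: "((\<lambda>e. (cmod (e i))\<^sup>2) has_sum 1) B" if "i \<in> I" for i
    using orthonormal_basis_column_sum[OF B that] .
  have colc: "((\<lambda>e. d i * of_real ((cmod (e i))\<^sup>2)) has_sum d i) B" if "i \<in> I" for i
    using has_sum_cmult_right[OF has_sum_of_real[OF col[OF that]], of "d i"] by simp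
  have "(\<lambda>(i, e). cmod (d i * of_real ((cmod (e i))\<^sup>2))) summable_on I \<times> B"
  proof (rule summable_on_SigmaI[where g = "\<lambda>i. cmod (d i)"])
    show "((\<lambda>e. case (i, e) of (i, e) \<Rightarrow> cmod (d i * of_real ((cmod (e i))\<^sup>2))) has_sum cmod (d i)) B"
      if "i \<in> I" for i
      using has_sum_cmult_right[OF col[OF that], of "cmod (d i)"] by (simp add: norm_mult norm_power)
  qed (use abs in auto)
  then have summable: "(\<lambda>(i, e). d i * of_real ((cmod (e i))\<^sup>2)) summable_on I \<times> B"
    unfolding case_prod_unfold by (rule abs_summable_summable)
  have "((\<lambda>(i, e). d i * of_real ((cmod (e i))\<^sup>2)) has_sum \<tau>) (I \<times> B)"
    by (rule has_sum_SigmaI[OF _ d summable]) (use colc in simp)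
  then have swap: "((\<lambda>(e, i). d i * of_real ((cmod (e i))\<^sup>2)) has_sum \<tau>) (B \<times> I)"
    unfolding has_sum_swap[where A = I and B = B] by simp
  have "((\<lambda>e. \<Sum>\<^sub>\<infinity>i\<in>I. d i * of_real ((cmod (e i))\<^sup>2)) has_sum \<tau>) B"
  proof (rule has_sum_SigmaD[OF swap])
    fix e assume "e \<in> B"
    have "(\<lambda>(e, i). d i * of_real ((cmod (e i))\<^sup>2)) summable_on B \<times> I"
      using swap by (rule has_sum_imp_summable)
    from summable_on_SigmaD1[OF this \<open>e \<in> B\<close>]
    show "((\<lambda>i. case (e, i) of (e, i) \<Rightarrow> d i * of_real ((cmod (e i))\<^sup>2)) has_sum
        (\<Sum>\<^sub>\<infinity>i\<in>I. d i * of_real ((cmod (e i))\<^sup>2))) I"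
      by simp
  qed
  then show "((\<lambda>e. ip e (THE y. (e, y) \<in> diag_op I d)) has_sum \<tau>) B"
    by (rule has_sum_cong[THEN iffD1, rotated]) (use val in simp)
qed

section \<open>The modulus of the Dirac operator\<close>

lemma ell2_Plus_iff:
  "z \<in> ell2 (A <+> B) \<longleftrightarrow> (\<lambda>i. z (Inl i)) \<in> ell2 A \<and> (\<lambda>i. z (Inr i)) \<in> ell2 B"
proof -
  have "(\<lambda>i. (cmod (z i))\<^sup>2) summable_on (A <+> B) \<longleftrightarrow>
      (\<lambda>i. (cmod (z i))\<^sup>2) summable_on Inl ` A \<and> (\<lambda>i. (cmod (z i))\<^sup>2) summable_on Inr ` B"
    unfolding Plus_def
    by (auto intro: summable_on_union summable_on_subset_banach)
  also have "\<dots> \<longleftrightarrow> (\<lambda>i. (cmod (z (Inl i)))\<^sup>2) summable_on A \<and> (\<lambda>i. (cmod (z (Inr i)))\<^sup>2) summable_on B"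
    by (subst (1 2) summable_on_reindex) (auto simp: o_def)
  moreover have "(\<forall>i. i \<notin> A <+> B \<longrightarrow> z i = 0) \<longleftrightarrow>
      (\<forall>i. i \<notin> A \<longrightarrow> z (Inl i) = 0) \<and> (\<forall>i. i \<notin> B \<longrightarrow> z (Inr i) = 0)"
    by (auto elim!: PlusE) (metis InlI InrI PlusE sum.exhaust)
  ultimately show ?thesis by (auto simp: ell2_def)
qed

text \<open>In the standard basis the Dirac operator is a weighted permutation; this involution is
  the permutation.\<close>

definition sheet_swap :: "'a + 'a \<Rightarrow> 'a + 'a" where
  "sheet_swap = case_sum Inr Inl"

text \<open>The eigenvalue of \<open>D\<close> on either summand, without the factor
  \<open>cmod w\<close>; \<open>case_sum fst fst\<close> extracts \<open>l\<close>.\<close>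

definition eigenvalue :: "real \<Rightarrow> real \<times> real + real \<times> real \<Rightarrow> real" where
  "eigenvalue q i = qnum q (case_sum fst fst i + 1 / 2)"

text \<open>Indexed by the row of the operator matrix, that is, by the component of the
  output.\<close>

definition offdiag :: "complex \<Rightarrow> 'a + 'a \<Rightarrow> complex" where
  "offdiag w = case_sum (\<lambda>_. cnj w) (\<lambda>_. w)"

lemma sheet_swap_simps [simp]:
  "sheet_swap (Inl j) = Inr j" "sheet_swap (Inr j) = Inl j"
  by (auto simp: sheet_swap_def)

lemma sheet_swap_sheet_swap [simp]: "sheet_swap (sheet_swap i) = i"
  by (cases i) auto

lemma sheet_swap_in_labels2 [simp]: "sheet_swap i \<in> labels2 \<longleftrightarrow> i \<in> labels2"
  by (cases i) (auto simp: labels2_def)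

lemma eigenvalue_sheet_swap [simp]: "eigenvalue q (sheet_swap i) = eigenvalue q i"
  by (cases i) (auto simp: eigenvalue_def)

lemma offdiag_sheet_swap [simp]: "offdiag w (sheet_swap i) = cnj (offdiag w i)"
  by (cases i) (auto simp: offdiag_def)

lemma cnj_offdiag_mult [simp]: "offdiag w i * cnj (offdiag w i) = of_real ((cmod w)\<^sup>2)"
  by (cases i) (simp_all add: offdiag_def complex_norm_square mult.commute del: of_real_power)

lemma cmod_offdiag [simp]: "cmod (offdiag w i) = cmod w"
  by (cases i) (auto simp: offdiag_def)

text \<open>Since \<open>w \<noteq> 0\<close>, the images under \<open>D_half\<close> can be
  recovered from \<open>y\<close> by division, so the domain is the maximal one.\<close>

lemma Dirac_iff:
  assumes "w \<noteq> 0"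
  shows "(x, y) \<in> Dirac q w \<longleftrightarrow> x \<in> ell2 labels2 \<and> y \<in> ell2 labels2 \<and>
    (\<forall>i\<in>labels2. y i = offdiag w i * of_real (eigenvalue q i) * x (sheet_swap i))" (is "_ \<longleftrightarrow> ?R x y")
proof
  assume "(x, y) \<in> Dirac q w"
  then show "?R x y"
    by (auto simp: Dirac_def D_half_def labels2_def ell2_Plus_iff ell2_cmult offdiag_def
        eigenvalue_def split_beta)
next
  assume R: "?R x y"
  define x1 where "x1 = (\<lambda>j. x (Inl j))"
  define x2 where "x2 = (\<lambda>j. x (Inr j))"
  define y1 where "y1 = (\<lambda>j. inverse w * y (Inr j))"
  define y2 where "y2 = (\<lambda>j. inverse (cnj w) * y (Inl j))"
  have "(x1, y1) \<in> D_half q" "(x2, y2) \<in> D_half q"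
    using R assms unfolding x1_def y1_def x2_def y2_def D_half_def
    by (auto simp: labels2_def ell2_Plus_iff ell2_cmult offdiag_def eigenvalue_def InlI InrI)
  moreover have "x = case_sum x1 x2"
    by (auto simp: x1_def x2_def fun_eq_iff split: sum.splits)
  moreover have "y = case_sum (\<lambda>j. cnj w * y2 j) (\<lambda>j. w * y1 j)"
    using assms by (auto simp: y1_def y2_def fun_eq_iff split: sum.splits)
  ultimately show "(x, y) \<in> Dirac q w"
    unfolding Dirac_def by blast
qed

lemma Dirac_subset: "w \<noteq> 0 \<Longrightarrow> Dirac q w \<subseteq> ell2 labels2 \<times> ell2 labels2"
  by (auto simp: Dirac_iff)

text \<open>One inclusion comes from testing against basis vectors, the other from reindexing the
  inner product by \<open>sheet_swap\<close>, which conjugates \<open>offdiag\<close>.\<close>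

lemma adj_Dirac:
  assumes w: "w \<noteq> 0"
  shows "adj labels2 (Dirac q w) = Dirac q w"
proof
  show "adj labels2 (Dirac q w) \<subseteq> Dirac q w"
  proof clarify
    fix y z assume "(y, z) \<in> adj labels2 (Dirac q w)"
    then have y: "y \<in> ell2 labels2" and z: "z \<in> ell2 labels2"
      and eq: "\<And>x x'. (x, x') \<in> Dirac q w \<Longrightarrow> ip x' y = ip x z"
      by (auto simp: adj_def)
    have "z i = offdiag w i * of_real (eigenvalue q i) * y (sheet_swap i)" if i: "i \<in> labels2" for i
    proof -
      \<comment> \<open>The image sits at \<open>sheet_swap i\<close>, whose coefficient is the
        conjugate one; \<open>ip\<close> conjugates it back.\<close>
      have "(delta i, \<lambda>j. cnj (offdiag w i) * of_real (eigenvalue q i) * delta (sheet_swap i) j) \<in> Dirac q w"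
        using i by (auto simp: Dirac_iff[OF w] delta_ell2 ell2_cmult)
          (auto simp: delta_def)
      from eq[OF this] show ?thesis
        by (simp add: ip_scaled_delta_left ip_delta_left)
    qed
    with y z show "(y, z) \<in> Dirac q w" by (simp add: Dirac_iff[OF w])
  qed
next
  have "ip x' y = ip x z" if xx': "(x, x') \<in> Dirac q w" and yz: "(y, z) \<in> Dirac q w" for x x' y z
  proof -
    have "bij sheet_swap" by (rule involuntory_imp_bij) simp
    then have "ip x' y = (\<Sum>\<^sub>\<infinity>i. cnj (x' (sheet_swap i)) * y (sheet_swap i))"
      unfolding ip_def by (rule infsum_reindex_bij_betw[symmetric])
    also have "\<dots> = ip x z"
      unfolding ip_def
    proof (rule infsum_cong)
      fix i :: "real \<times> real + real \<times> real"
      show "cnj (x' (sheet_swap i)) * y (sheet_swap i) = cnj (x i) * z i"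
      proof (cases "i \<in> labels2")
        case True
        then have "x' (sheet_swap i) = cnj (offdiag w i) * of_real (eigenvalue q i) * x i"
          "z i = offdiag w i * of_real (eigenvalue q i) * y (sheet_swap i)"
          using xx' yz by (auto simp: Dirac_iff[OF w])
        then show ?thesis by simp
      next
        case False
        then have "y (sheet_swap i) = 0" "z i = 0"
          using yz by (simp_all add: Dirac_iff[OF w] ell2_outside[of _ labels2])
        then show ?thesis by simp
      qed
    qed
    finally show ?thesis .
  qed
  then show "Dirac q w \<subseteq> adj labels2 (Dirac q w)"
    by (auto simp: adj_def dest: subsetD[OF Dirac_subset[OF w]])
qed

text \<open>The two compositions pass through different middle vectors, which agree in absolute
  value after a sheet swap. Hence one is square-summable when the other is, and the two weights
  multiply to \<open>(cmod w)\<^sup>2\<close>.\<close>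

lemma Dirac_squared:
  fixes q :: real and w :: complex
  assumes w: "w \<noteq> 0"
  defines "M \<equiv> diag_op labels2 (\<lambda>i. of_real (cmod w * eigenvalue q i))"
  shows "Dirac q w O Dirac q w = M O M"
proof (intro equalityI subsetI; clarify)
  fix x y z assume xy: "(x, y) \<in> Dirac q w" and yz: "(y, z) \<in> Dirac q w"
  define y' where "y' = (\<lambda>i. if i \<in> labels2 then of_real (cmod w * eigenvalue q i) * x i else 0)"
  have y'norm: "cmod (y' i) = cmod (y (sheet_swap i))" for i
    using xy by (cases "i \<in> labels2")
      (auto simp: y'_def Dirac_iff[OF w] norm_mult ell2_outside)
  have "(\<lambda>i. y (sheet_swap i)) \<in> ell2 labels2"
    using xy by (auto simp: Dirac_iff[OF w] labels2_def ell2_Plus_iff)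
  then have "y' \<in> ell2 labels2"
    by (rule ell2_dominated[where C = 1]) (auto simp: y'norm, simp add: y'_def)
  moreover have "z i = of_real (cmod w * eigenvalue q i) * y' i" if "i \<in> labels2" for i
  proof -
    have "z i = (offdiag w i * cnj (offdiag w i)) * of_real (eigenvalue q i) * of_real (eigenvalue q i) * x i"
      using xy yz that by (simp add: Dirac_iff[OF w] mult_ac)
    also have "\<dots> = of_real (cmod w * eigenvalue q i) * y' i"
      unfolding cnj_offdiag_mult using that by (simp add: y'_def power2_eq_square)
    finally show ?thesis .
  qed
  ultimately show "(x, z) \<in> M O M"
    using xy yz unfolding M_def
    by (intro relcompI[of x y']) (auto simp: diag_op_def Dirac_iff[OF w] y'_def)
next
  fix x y z assume xy: "(x, y) \<in> M" and yz: "(y, z) \<in> M"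
  define y' where "y' = (\<lambda>i. if i \<in> labels2 then offdiag w i * of_real (eigenvalue q i) * x (sheet_swap i) else 0)"
  have y'norm: "cmod (y' i) = cmod (y (sheet_swap i))" for i
    using xy by (cases "i \<in> labels2")
      (auto simp: y'_def M_def diag_op_def norm_mult ell2_outside)
  have "(\<lambda>i. y (sheet_swap i)) \<in> ell2 labels2"
    using xy by (auto simp: M_def diag_op_def labels2_def ell2_Plus_iff)
  then have "y' \<in> ell2 labels2"
    by (rule ell2_dominated[where C = 1]) (auto simp: y'norm, simp add: y'_def)
  moreover have "z i = offdiag w i * of_real (eigenvalue q i) * y' (sheet_swap i)" if "i \<in> labels2" for i
  proof -
    have "offdiag w i * of_real (eigenvalue q i) * y' (sheet_swap i) =
        (offdiag w i * cnj (offdiag w i)) * of_real (eigenvalue q i) * of_real (eigenvalue q i) * x i"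
      using that by (simp add: y'_def mult_ac)
    also have "\<dots> = z i"
      unfolding cnj_offdiag_mult using xy yz that by (simp add: M_def diag_op_def power2_eq_square)
    finally show ?thesis ..
  qed
  ultimately show "(x, z) \<in> Dirac q w O Dirac q w"
    using xy yz unfolding M_def
    by (intro relcompI[of x y']) (auto simp: diag_op_def Dirac_iff[OF w] y'_def)
qed

lemma qnum_pos:
  assumes "0 < q" "q < 1" "0 < n"
  shows "0 < qnum q n"
proof -
  have "q powr n < q powr (- n)" "q powr 1 < q powr (- 1)"
    by (rule powr_less_mono'; use assms in simp)+
  moreover have "q powr 1 = q" using assms(1) by simp
  ultimately show ?thesis unfolding qnum_def by (intro divide_pos_pos) linarith+
qed

lemma eigenvalue_pos:
  assumes "0 < q" "q < 1" "i \<in> labels2"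
  shows "0 < eigenvalue q i"
  using assms by (auto simp: eigenvalue_def labels2_def labels_def intro!: qnum_pos)

lemma modulus_Dirac:
  assumes "0 < q" "q < 1" "w \<noteq> 0"
  shows "modulus labels2 (Dirac q w) = diag_op labels2 (\<lambda>i. of_real (cmod w * eigenvalue q i))"
  using assms by (intro modulus_eq_diag_op) (simp_all add: eigenvalue_pos adj_Dirac Dirac_squared)

text \<open>At \<open>l = 1/2 + n\<close> there are \<open>2 * l + 1 = 2 * (n + 1)\<close> values of
  \<open>m\<close>, numbered by \<open>k \<le> 2 * n + 1\<close>, and
  \<open>l + 1/2 = n + 1\<close>.\<close>

lemma has_sum_labels:
  fixes H :: "real \<Rightarrow> complex"
  assumes "((\<lambda>n. 2 * of_nat (Suc n) * H (real (Suc n))) has_sum \<tau>) UNIV"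
  shows "((\<lambda>(l, m). H (l + 1 / 2)) has_sum \<tau>) labels"
proof -
  define S where "S = (SIGMA n:(UNIV :: nat set). {..2 * n + 1})"
  define \<phi> where "\<phi> = (\<lambda>(n, k). (1 / 2 + real n, - (1 / 2 + real n) + real k))"
  have inner: "((\<lambda>k. H (real (Suc n))) has_sum 2 * of_nat (Suc n) * H (real (Suc n))) {..2 * n + 1}"
    and inner': "((\<lambda>k. cmod (H (real (Suc n)))) has_sum cmod (2 * of_nat (Suc n) * H (real (Suc n)))) {..2 * n + 1}"
    for n
    by (rule has_sum_finiteI; simp add: norm_mult del: of_nat_Suc; simp add: algebra_simps)+
  have "(\<lambda>(n, k). cmod (H (real (Suc n)))) summable_on S"
    unfolding S_def
  proof (rule summable_on_SigmaI)
    show "(\<lambda>n. cmod (2 * of_nat (Suc n) * H (real (Suc n)))) summable_on UNIV"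
      using has_sum_imp_summable[OF assms] by (simp only: summable_on_iff_abs_summable_on_complex)
  qed (use inner' in auto)
  then have "(\<lambda>(n, k). H (real (Suc n))) summable_on S"
    unfolding case_prod_unfold by (rule abs_summable_summable)
  then have "((\<lambda>(n, k). H (real (Suc n))) has_sum \<tau>) S"
    unfolding S_def by (intro has_sum_SigmaI[OF _ assms]) (use inner in auto)
  moreover have "bij_betw \<phi> S labels"
  proof (rule bij_betw_imageI)
    show "inj_on \<phi> S" by (auto simp: \<phi>_def inj_on_def)
    have "\<exists>n k. k \<le> 2 * n + 1 \<and> l = 1 / 2 + real n \<and> m = - l + real k" if lm: "(l, m) \<in> labels" for l m
    proof -
      obtain n k where "l = 1 / 2 + real n" "real k \<le> 2 * l" "m = - l + real k"
        using lm unfolding labels_def by blast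
      then show ?thesis by (intro exI[of _ n] exI[of _ k]) (auto simp: algebra_simps)
    qed
    moreover have "\<phi> (n, k) \<in> labels" if "k \<le> 2 * n + 1" for n k
      using that unfolding labels_def \<phi>_def by (auto intro!: exI[of _ n] exI[of _ k])
    ultimately show "\<phi> ` S = labels"
      by (fastforce simp: S_def \<phi>_def image_iff)
  qed
  ultimately show ?thesis
    by (subst has_sum_reindex_bij_betw[symmetric, of \<phi> S])
      (auto simp: \<phi>_def case_prod_unfold algebra_simps)
qed

lemma has_sum_labels2:
  fixes H :: "real \<Rightarrow> complex"
  assumes "((\<lambda>n. 2 * of_nat (Suc n) * H (real (Suc n))) has_sum \<tau>) UNIV"
  shows "((\<lambda>i. H (case_sum fst fst i + 1 / 2)) has_sum 2 * \<tau>) labels2"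
proof -
  have "((\<lambda>i. H (case_sum fst fst i + 1 / 2)) has_sum \<tau>) (Inl ` labels)"
    "((\<lambda>i. H (case_sum fst fst i + 1 / 2)) has_sum \<tau>) (Inr ` labels)"
    using has_sum_labels[OF assms]
    by (subst has_sum_reindex; simp add: o_def case_prod_unfold)+
  from has_sum_Un_disjoint[OF this] show ?thesis
    by (auto simp: labels2_def Plus_def)
qed

section \<open>The zeta series\<close>

text \<open>The unsquared denominator is named because its zeros are simple and make up
  \<open>Sd1\<close>.\<close>

definition q_denom :: "real \<Rightarrow> nat \<Rightarrow> complex \<Rightarrow> complex" where
  "q_denom q n s = 1 - of_real q powr (s + 2 * of_nat n)"

definition zeta_term :: "real \<Rightarrow> nat \<Rightarrow> complex \<Rightarrow> complex" where
  "zeta_term q n s = pochhammer s n / fact n * (of_real q ^ (2 * n) / (q_denom q n s)\<^sup>2)"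

section \<open>Binomial series and majorants\<close>

text \<open>The signs of \<open>(- s) gchoose k\<close> and \<open>(- z) ^ k\<close> cancel, leaving
  the Pochhammer coefficients.\<close>

lemma binomial_series_minus:
  assumes "cmod z < 1"
  shows "(\<lambda>k. pochhammer s k / fact k * z ^ k) sums (1 - z) powr (- s)"
proof -
  have "((- s) gchoose k) * (- z) ^ k = pochhammer s k / fact k * z ^ k" for k
    using power_minus[of z k] by (simp add: gbinomial_pochhammer flip: power_mult_distrib mult.assoc)
  then show ?thesis using gen_binomial_complex[of "- z" "- s"] assms by simp
qed

lemma cmod_pochhammer_le:
  assumes "cmod s \<le> R"
  shows "cmod (pochhammer s n) \<le> pochhammer R n"
  unfolding pochhammer_prod prod_norm[symmetric]
proof (rule prod_mono, safe)
  fix i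
  show "cmod (s + of_nat i) \<le> R + of_nat i"
    using norm_triangle_ineq[of s "of_nat i"] assms by simp
qed simp

text \<open>The real binomial series with exponent \<open>- R\<close>; it provides the majorants for
  the Weierstrass test and for the double sum.\<close>

lemma summable_pochhammer:
  fixes R z :: real
  assumes "\<bar>z\<bar> < 1"
  shows "summable (\<lambda>k. pochhammer R k / fact k * z ^ k)"
proof -
  have "((- R) gchoose k) * (- z) ^ k = pochhammer R k / fact k * z ^ k" for k
    using power_minus[of z k] by (simp add: gbinomial_pochhammer flip: power_mult_distrib mult.assoc)
  then show ?thesis using gen_binomial_real[of "- z" "- R"] assms by (simp add: sums_iff)
qed

section \<open>Zeros of the denominators\<close>

lemma cmod_q_powr:
  assumes "0 < q"
  shows "cmod (of_real q powr z) = q powr Re z"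
  using assms by (subst norm_powr_real_powr) auto

text \<open>The power is \<open>exp ((s + 2 n) ln q)\<close>, so the exponent must be an integer
  multiple of \<open>2 pi i\<close>. Each \<open>n\<close> contributes one vertical line of
  \<open>Sd1\<close>.\<close>

lemma q_denom_eq_0_iff:
  assumes "0 < q" "q < 1"
  shows "q_denom q n s = 0 \<longleftrightarrow> (\<exists>j::int. s = - 2 * of_nat n + \<i> * of_real (2 * pi / ln q) * of_int j)"
proof -
  have ln: "ln q \<noteq> 0" using assms by simp
  have "q_denom q n s = 0 \<longleftrightarrow> exp ((s + 2 * of_nat n) * of_real (ln q)) = 1"
    using assms by (auto simp: q_denom_def powr_def Ln_of_real)
  also have "\<dots> \<longleftrightarrow> (Re s + 2 * real n) * ln q = 0 \<and> (\<exists>j::int. Im s * ln q = of_int (2 * j) * pi)"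
    by (simp add: exp_eq_1)
  also have "\<dots> \<longleftrightarrow> (\<exists>j::int. s = - 2 * of_nat n + \<i> * of_real (2 * pi / ln q) * of_int j)"
  proof -
    have "(Re s + 2 * real n) * ln q = 0 \<longleftrightarrow> Re s = - 2 * real n"
      using ln by (auto simp: add_eq_0_iff2)
    moreover have "Im s * ln q = of_int (2 * j) * pi \<longleftrightarrow> Im s = 2 * pi / ln q * of_int j" for j
      using ln by (auto simp: field_simps)
    ultimately show ?thesis by (simp add: complex_eq_iff)
  qed
  finally show ?thesis .
qed

lemma Sd1_iff:
  assumes "0 < q" "q < 1"
  shows "s \<in> Sd1 q \<longleftrightarrow> (\<exists>n. q_denom q n s = 0)"
  using q_denom_eq_0_iff[OF assms] by (auto simp: Sd1_def)

text \<open>Zeros for different indices lie on different vertical lines, so singularities of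
  different terms never meet.\<close>

lemma Re_q_denom_zero:
  assumes "0 < q" "q < 1" "q_denom q n s = 0"
  shows "Re s = - 2 * real n"
  using assms q_denom_eq_0_iff[OF assms(1,2)] by auto

text \<open>At a zero the power equals \<open>1\<close>, so the derivative is \<open>- ln q\<close>,
  which is nonzero for \<open>0 < q < 1\<close>.\<close>

lemma q_denom_has_field_derivative:
  assumes "0 < q"
  shows "(q_denom q n has_field_derivative
    - (of_real q powr (s + 2 * of_nat n) * of_real (ln q))) (at s)"
  unfolding q_denom_def powr_def using assms
  by (auto intro!: derivative_eq_intros simp: Ln_of_real)

lemma q_denom_holomorphic:
  assumes "0 < q"
  shows "q_denom q n holomorphic_on A"
  using q_denom_has_field_derivative[OF assms]
  by (auto simp: holomorphic_on_def field_differentiable_def intro: has_field_derivative_at_within)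

lemma q_denom_analytic: "0 < q \<Longrightarrow> q_denom q n analytic_on A"
  using q_denom_holomorphic[of q n UNIV] by (auto simp: analytic_on_open[symmetric] intro: analytic_on_subset)

lemma pochhammer_analytic: "(\<lambda>s. pochhammer s n) analytic_on A"
  unfolding pochhammer_prod by (intro analytic_intros)

section \<open>Convergence and analyticity of the series\<close>

lemma zeta_term_analytic:
  assumes "0 < q" "\<And>s. s \<in> A \<Longrightarrow> q_denom q n s \<noteq> 0"
  shows "zeta_term q n analytic_on A"
  unfolding zeta_term_def
  by (intro analytic_intros pochhammer_analytic q_denom_analytic) (use assms in auto)

lemma q_denom_nonzero:
  assumes "0 < q" "q < 1" "Re s > - 2 * real n"
  shows "q_denom q n s \<noteq> 0"
  using Re_q_denom_zero[OF assms(1,2)] assms(3) by auto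

text \<open>The power in the denominator has modulus at most \<open>q powr \<delta> < 1\<close>,
  which keeps the denominator away from zero uniformly in \<open>s\<close> and
  \<open>n\<close>.\<close>

lemma zeta_term_bound:
  assumes "0 < q" "q < 1" "0 < \<delta>" "\<delta> \<le> Re s + 2 * real n" "cmod s \<le> R"
  shows "cmod (zeta_term q n s) \<le> pochhammer R n / fact n * (q\<^sup>2) ^ n * inverse ((1 - q powr \<delta>)\<^sup>2)"
proof -
  have "q powr (Re s + 2 * real n) \<le> q powr \<delta>"
    using assms by (intro powr_mono') auto
  then have "1 - q powr \<delta> \<le> 1 - cmod (of_real q powr (s + 2 * of_nat n))"
    using assms by (simp add: cmod_q_powr)
  also have "\<dots> \<le> cmod (q_denom q n s)"
    unfolding q_denom_def using norm_triangle_ineq2[of 1] by (metis norm_one)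
  finally have den: "1 - q powr \<delta> \<le> cmod (q_denom q n s)" .
  have "q powr \<delta> < 1" using assms by (simp add: powr01_less_one)
  then have "inverse ((cmod (q_denom q n s))\<^sup>2) \<le> inverse ((1 - q powr \<delta>)\<^sup>2)"
    using den by (intro le_imp_inverse_le power_mono) auto
  moreover have "cmod (pochhammer s n) / fact n * (q\<^sup>2) ^ n \<le> pochhammer R n / fact n * (q\<^sup>2) ^ n"
    using cmod_pochhammer_le[OF assms(5)] by (intro mult_right_mono divide_right_mono) auto
  ultimately have "cmod (pochhammer s n) / fact n * (q\<^sup>2) ^ n * inverse ((cmod (q_denom q n s))\<^sup>2)
      \<le> pochhammer R n / fact n * (q\<^sup>2) ^ n * inverse ((1 - q powr \<delta>)\<^sup>2)"
    using order_trans[OF norm_ge_zero cmod_pochhammer_le[OF assms(5)], of n]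
    by (intro mult_mono[OF _ _ mult_nonneg_nonneg]) auto
  also have "cmod (pochhammer s n) / fact n * (q\<^sup>2) ^ n * inverse ((cmod (q_denom q n s))\<^sup>2) =
      cmod (zeta_term q n s)"
  proof -
    have "(of_real q :: complex) ^ (2 * n) = of_real ((q\<^sup>2) ^ n)" by (simp add: power_mult)
    then show ?thesis
      unfolding zeta_term_def norm_mult norm_divide norm_power
      by (simp add: norm_power divide_inverse power_mult)
  qed
  finally show ?thesis .
qed

text \<open>Dropping the first \<open>N\<close> terms removes every term that could be singular on
  \<open>A\<close>.\<close>

lemma zeta_term_tail_uniform_limit:
  assumes "0 < q" "q < 1" "0 < \<delta>" "\<And>s. s \<in> A \<Longrightarrow> \<delta> \<le> Re s + 2 * real N" "\<And>s. s \<in> A \<Longrightarrow> cmod s \<le> R"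
  shows "uniform_limit A (\<lambda>m s. \<Sum>n<m. zeta_term q (n + N) s) (\<lambda>s. \<Sum>n. zeta_term q (n + N) s) sequentially"
proof (rule Weierstrass_m_test)
  define M where "M n = pochhammer R n / fact n * (q\<^sup>2) ^ n * inverse ((1 - q powr \<delta>)\<^sup>2)" for n
  have "q\<^sup>2 < 1" using assms by (simp add: power_less_one_iff)
  then have "summable M"
    unfolding M_def by (intro summable_mult2 summable_pochhammer) simp
  then show "summable (\<lambda>n. M (n + N))" by (simp add: summable_iff_shift)
  show "norm (zeta_term q (n + N) s) \<le> M (n + N)" if "s \<in> A" for n s
    unfolding M_def using assms(1-3) assms(4)[OF that] assms(5)[OF that]
    by (intro zeta_term_bound) auto
qed

text \<open>Convergence depends only on a tail, taken where \<open>Re s + 2 N > 0\<close>. At a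
  point of \<open>Sd1\<close> the singular term has the value \<open>0\<close>, by the convention
  for division by zero.\<close>

lemma zeta_term_summable:
  assumes "0 < q" "q < 1"
  shows "summable (\<lambda>n. zeta_term q n s)"
proof -
  obtain N :: nat where N: "- Re s < real N" using reals_Archimedean2 by blast
  then have "\<exists>N :: nat. 0 < Re s + 2 * real N" by (intro exI[of _ N]) linarith
  then obtain N :: nat where "0 < Re s + 2 * real N" ..
  then have "uniform_limit {s} (\<lambda>m s. \<Sum>n<m. zeta_term q (n + N) s) (\<lambda>s. \<Sum>n. zeta_term q (n + N) s) sequentially"
    by (intro zeta_term_tail_uniform_limit[OF assms, where R = "cmod s"]) auto
  then have "(\<lambda>m. \<Sum>n<m. zeta_term q (n + N) s) \<longlonglongrightarrow> (\<Sum>n. zeta_term q (n + N) s)"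
    by (rule tendsto_uniform_limitI) simp
  then have "summable (\<lambda>n. zeta_term q (n + N) s)"
    unfolding summable_def sums_def by blast
  then show ?thesis using summable_iff_shift[of "\<lambda>n. zeta_term q n s" N] by simp
qed

lemma zeta_term_tail_analytic:
  assumes "0 < q" "q < 1" "Re z > - 2 * real N"
  shows "(\<lambda>s. \<Sum>n. zeta_term q (n + N) s) analytic_on {z}"
proof -
  define S where "S = {s. Re s > - 2 * real N}"
  have S: "open S" unfolding S_def by (rule open_halfspace_Re_gt)
  have "(\<lambda>s. \<Sum>n. zeta_term q (n + N) s) holomorphic_on S"
  proof (rule holomorphic_uniform_sequence[OF S])
    show "(\<lambda>s. \<Sum>n<m. zeta_term q (n + N) s) holomorphic_on S" for m
      using assms unfolding S_def
      by (intro holomorphic_on_sum analytic_imp_holomorphic zeta_term_analytic q_denom_nonzero) auto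
    fix x assume x: "x \<in> S"
    \<comment> \<open>Half the distance from \<open>x\<close> to the boundary line, so the closed
      disc stays at distance at least \<open>d\<close> from it.\<close>
    define d where "d = (Re x + 2 * real N) / 2"
    have d: "0 < d" using x by (simp add: S_def d_def)
    have Re: "d \<le> Re s + 2 * real N" if "s \<in> cball x d" for s
      using that abs_Re_le_cmod[of "x - s"] by (simp add: d_def dist_norm)
    have norm: "cmod s \<le> cmod x + d" if "s \<in> cball x d" for s
      using that norm_triangle_ineq2[of s x] by (simp add: dist_norm norm_minus_commute)
    have "cball x d \<subseteq> S" using Re d by (force simp: S_def)
    moreover have "uniform_limit (cball x d) (\<lambda>m s. \<Sum>n<m. zeta_term q (n + N) s)
        (\<lambda>s. \<Sum>n. zeta_term q (n + N) s) sequentially"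
      using Re norm by (intro zeta_term_tail_uniform_limit[OF assms(1,2) d]) auto
    ultimately show "\<exists>d>0. cball x d \<subseteq> S \<and> uniform_limit (cball x d)
        (\<lambda>m s. \<Sum>n<m. zeta_term q (n + N) s) (\<lambda>s. \<Sum>n. zeta_term q (n + N) s) sequentially"
      using d by blast
  qed
  then show ?thesis
    using S assms(3) analytic_at[of _ z] by (auto simp: S_def)
qed

lemma zeta_series_analytic:
  assumes "0 < q" "q < 1" "z \<notin> Sd1 q"
  shows "(\<lambda>s. \<Sum>n. zeta_term q n s) analytic_on {z}"
proof -
  \<comment> \<open>As \<open>N\<close> is nonnegative, this also gives
    \<open>- 2 * N < Re z\<close>, which the tail requires.\<close>
  obtain N :: nat where N: "- Re z < real N" using reals_Archimedean2 by blast
  have "(\<lambda>s. (\<Sum>n. zeta_term q (n + N) s) + (\<Sum>n<N. zeta_term q n s)) analytic_on {z}"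
  proof (intro analytic_on_add analytic_on_sum zeta_term_tail_analytic zeta_term_analytic assms)
    show "- 2 * real N < Re z" using N by linarith
    show "q_denom q n s \<noteq> 0" if "s \<in> {z}" for n s
      using assms that by (auto simp: Sd1_iff)
  qed
  also have "(\<lambda>s. (\<Sum>n. zeta_term q (n + N) s) + (\<Sum>n<N. zeta_term q n s)) = (\<lambda>s. \<Sum>n. zeta_term q n s)"
    using suminf_split_initial_segment[OF zeta_term_summable[OF assms(1,2)]] by (intro ext) (rule sym)
  finally show ?thesis .
qed

section \<open>Double poles\<close>

text \<open>All three conclusions depend only on a punctured neighbourhood. The value
  \<open>f z\<close> is left free, since the series takes a merely conventional value at its
  poles.\<close>

lemma double_pole:
  fixes f g :: "complex \<Rightarrow> complex"
  assumes g: "g analytic_on {z}" "g z \<noteq> 0" and f: "\<And>s. s \<noteq> z \<Longrightarrow> f s = g s / (s - z)\<^sup>2"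
  shows "is_pole f z" "zorder f z = - 2" "f meromorphic_on {z}"
proof -
  obtain S where S: "open S" "z \<in> S" "g holomorphic_on S"
    using g(1) analytic_at by blast
  have ev: "eventually (\<lambda>s. f s = g s / (s - z)\<^sup>2) (at z)"
    using f by (auto simp: eventually_at_filter)
  have "zorder (\<lambda>s. g s / (s - z)\<^sup>2) z = - int 2"
    by (rule zorder_nonzero_div_power[OF S g(2)]) simp
  then show "zorder f z = - 2"
    using zorder_cong[OF ev refl] by simp
  have "is_pole (\<lambda>s. g s / (s - z)\<^sup>2) z"
    by (rule is_pole_basic[OF S(3,1,2) g(2)]) simp
  then show "is_pole f z"
    using is_pole_cong[OF ev refl] by simp
  have "(\<lambda>s. g s / (s - z)\<^sup>2) meromorphic_on {z}"
    by (intro meromorphic_intros analytic_on_imp_meromorphic_on g)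
  then show "f meromorphic_on {z}"
    using ev by (subst meromorphic_on_cong[of _ f]) auto
qed

text \<open>Only the term of index \<open>k\<close> is singular at a point of real part \<open>-2k\<close>; its denominator has a
  simple zero there, and its numerator does not vanish since \<open>s\<close> is not one of the zeros
  \<open>0, -1, \<dots>, 1 - k\<close> of the Pochhammer polynomial.\<close>

lemma zeta_series_numerator:
  assumes q: "0 < q" "q < 1" and "z \<in> Sd1 q"
  obtains g where "g analytic_on {z}" "g z \<noteq> 0"
    "\<And>s. s \<noteq> z \<Longrightarrow> (\<Sum>n. zeta_term q n s) = g s / (s - z)\<^sup>2"
proof -
  obtain k where k: "q_denom q k z = 0" using assms by (auto simp: Sd1_iff)
  have Re: "Re z = - 2 * real k" by (rule Re_q_denom_zero[OF q k])
  \<comment> \<open>The difference quotient with its removable singularity filled in, so that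
    \<open>q_denom q k s = h s * (s - z)\<close> with \<open>h\<close> analytic.\<close>
  define h where "h s = (if s = z then deriv (q_denom q k) z
    else (q_denom q k s - q_denom q k z) / (s - z))" for s
  have "h holomorphic_on UNIV"
    unfolding h_def by (rule pole_lemma[OF q_denom_holomorphic[OF q(1)]]) simp
  then have h: "h analytic_on {z}" by (auto simp: analytic_at intro: exI[of _ UNIV])
  have "h z = - (of_real q powr (z + 2 * of_nat k) * of_real (ln q))"
    using DERIV_imp_deriv[OF q_denom_has_field_derivative[OF q(1)]] by (simp add: h_def)
  moreover have "of_real q powr (z + 2 * of_nat k) = 1" using k by (simp add: q_denom_def)
  ultimately have hz: "h z \<noteq> 0" using q by simp
  have hs: "q_denom q k s = h s * (s - z)" for s
    using k by (simp add: h_def)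
  \<comment> \<open>All terms except the one of index \<open>k\<close>. The tail starts at
    \<open>Suc k\<close> and is therefore analytic for \<open>Re s > - 2 * (k + 1)\<close>, which
    includes \<open>z\<close>.\<close>
  define r where "r s = (\<Sum>n. zeta_term q (n + Suc k) s) + (\<Sum>n<k. zeta_term q n s)" for s
  have r: "r analytic_on {z}"
    unfolding r_def
  proof (intro analytic_on_add analytic_on_sum zeta_term_tail_analytic zeta_term_analytic q)
    show "q_denom q n s \<noteq> 0" if "n \<in> {..<k}" "s \<in> {z}" for n s
      using that Re Re_q_denom_zero[OF q, of n z] by auto
  qed (use Re in simp)
  define c where "c s = pochhammer s k / fact k * of_real q ^ (2 * k)" for s :: complex
  have c: "c analytic_on {z}"
    unfolding c_def by (intro analytic_intros pochhammer_analytic) simp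
  have "z \<noteq> - of_nat i" if "i < k" for i
    using Re that by (auto simp: complex_eq_iff)
  then have cz: "c z \<noteq> 0" using q by (auto simp: c_def pochhammer_eq_0_iff)
  show ?thesis
  proof (rule that)
    show "(\<lambda>s. c s / (h s)\<^sup>2 + (s - z)\<^sup>2 * r s) analytic_on {z}"
      using h r c hz by (intro analytic_intros) auto
    show "c z / (h z)\<^sup>2 + (z - z)\<^sup>2 * r z \<noteq> 0" using hz cz by simp
    fix s assume "s \<noteq> z"
    have "(\<Sum>n. zeta_term q n s) = (\<Sum>n. zeta_term q (n + Suc k) s) + (\<Sum>n<Suc k. zeta_term q n s)"
      by (rule suminf_split_initial_segment[OF zeta_term_summable[OF q]])
    also have "\<dots> = zeta_term q k s + r s" by (simp add: r_def)
    also have "zeta_term q k s = c s / ((h s)\<^sup>2 * (s - z)\<^sup>2)"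
      by (simp add: zeta_term_def c_def hs power_mult_distrib)
    also have "\<dots> + r s = (c s / (h s)\<^sup>2 + (s - z)\<^sup>2 * r s) / (s - z)\<^sup>2"
      using \<open>s \<noteq> z\<close> by (simp add: add_divide_distrib)
    finally show "(\<Sum>n. zeta_term q n s) = (c s / (h s)\<^sup>2 + (s - z)\<^sup>2 * r s) / (s - z)\<^sup>2" .
  qed
qed

lemma Sd1_infinite_countable:
  assumes "0 < q" "q < 1"
  shows "infinite (Sd1 q)" "countable (Sd1 q)"
proof -
  have "inj (\<lambda>k :: nat. - 2 * of_nat k + \<i> * of_real (2 * pi / ln q) * of_int 0 :: complex)"
    by (auto simp: inj_def)
  then have "infinite (range (\<lambda>k :: nat. - 2 * of_nat k + \<i> * of_real (2 * pi / ln q) * of_int 0 :: complex))"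
    by (rule range_inj_infinite)
  then show "infinite (Sd1 q)"
    by (rule infinite_super[rotated]) (auto simp: Sd1_def intro!: exI[of _ "0 :: int"])
  have "Sd1 q = (\<lambda>(k, j). - 2 * of_nat k + \<i> * of_real (2 * pi / ln q) * of_int j) ` (UNIV :: (nat \<times> int) set)"
    by (auto simp: Sd1_def)
  then show "countable (Sd1 q)" by simp
qed

section \<open>Interchange of the two summations\<close>

text \<open>The double family \<open>a k n\<close> is dominated by a product of a binomial series in
  \<open>k\<close> and an arithmetic-geometric series in \<open>n\<close>; the latter converges
  because \<open>Re s > 0\<close> makes \<open>cmod u < 1\<close>.\<close>

lemma has_sum_zeta_series:
  assumes q: "0 < q" "q < 1" and s: "Re s > 0"
  shows "((\<lambda>n. of_nat (Suc n) * (of_real q powr s) ^ n * (1 - of_real ((q\<^sup>2) ^ Suc n)) powr (- s))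
    has_sum (\<Sum>k. zeta_term q k s)) UNIV"
proof -
  define u where "u = (of_real q :: complex) powr s"
  define a where "a k n = pochhammer s k / fact k * of_nat (Suc n) * u ^ n * of_real (((q\<^sup>2) ^ Suc n) ^ k)" for k n
  have u: "cmod u < 1" using q s by (simp add: u_def cmod_q_powr powr01_less_one)
  have Q: "0 < q\<^sup>2" "q\<^sup>2 < 1" using q by (auto simp: power_less_one_iff)
  have QS: "(q\<^sup>2) ^ Suc n \<le> q\<^sup>2" for n
    using Q power_decreasing[of 1 "Suc n" "q\<^sup>2"] by simp
  have norm_a: "cmod (a k n) \<le> (pochhammer (cmod s) k / fact k * (q\<^sup>2) ^ k) * (real (Suc n) * cmod u ^ n)"
    for k n
  proof -
    \<comment> \<open>This crude bound decouples \<open>k\<close> from \<open>n\<close>.\<close>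
    have "((q\<^sup>2) ^ Suc n) ^ k \<le> (q\<^sup>2) ^ k" using QS by (intro power_mono) auto
    then have "cmod (pochhammer s k) * ((q\<^sup>2) ^ Suc n) ^ k \<le> pochhammer (cmod s) k * (q\<^sup>2) ^ k"
      using order_trans[OF norm_ge_zero cmod_pochhammer_le[OF order_refl]]
      by (intro mult_mono cmod_pochhammer_le) auto
    then have "cmod (pochhammer s k) * ((q\<^sup>2) ^ Suc n) ^ k / fact k * (real (Suc n) * cmod u ^ n)
        \<le> pochhammer (cmod s) k * (q\<^sup>2) ^ k / fact k * (real (Suc n) * cmod u ^ n)"
      by (intro mult_right_mono divide_right_mono) auto
    then show ?thesis
      by (simp add: a_def norm_mult norm_divide norm_power mult_ac del: of_nat_Suc power_Suc)
  qed
  have P: "(\<lambda>k. pochhammer (cmod s) k / fact k * (q\<^sup>2) ^ k) summable_on UNIV"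
    using Q by (intro summable_nonneg_imp_summable_on summable_pochhammer)
      (auto intro!: mult_nonneg_nonneg divide_nonneg_nonneg order_trans[OF norm_ge_zero cmod_pochhammer_le])
  have U: "((\<lambda>n. real (Suc n) * cmod u ^ n) has_sum 1 / (1 - cmod u)\<^sup>2) UNIV"
    using u by (intro sums_nonneg_imp_has_sum geometric_deriv_sums) auto
  have "(\<lambda>(k, n). (pochhammer (cmod s) k / fact k * (q\<^sup>2) ^ k) * (real (Suc n) * cmod u ^ n))
      summable_on UNIV \<times> UNIV"
  proof (rule summable_on_SigmaI)
    show "(\<lambda>k. pochhammer (cmod s) k / fact k * (q\<^sup>2) ^ k * (1 / (1 - cmod u)\<^sup>2)) summable_on UNIV"
      using P by (rule summable_on_cmult_left)
    show "((\<lambda>n. case (k, n) of (k, n) \<Rightarrow> (pochhammer (cmod s) k / fact k * (q\<^sup>2) ^ k) * (real (Suc n) * cmod u ^ n))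
        has_sum pochhammer (cmod s) k / fact k * (q\<^sup>2) ^ k * (1 / (1 - cmod u)\<^sup>2)) UNIV" for k
      unfolding prod.case by (rule has_sum_cmult_right[OF U])
    show "0 \<le> (case (k, n) of (k, n) \<Rightarrow> (pochhammer (cmod s) k / fact k * (q\<^sup>2) ^ k) * (real (Suc n) * cmod u ^ n))" for k n
      unfolding prod.case using order_trans[OF norm_ge_zero cmod_pochhammer_le[OF order_refl[of "cmod s"]], of k]
      by (intro mult_nonneg_nonneg divide_nonneg_nonneg) auto
  qed
  then have "(\<lambda>x. cmod (case x of (k, n) \<Rightarrow> a k n)) summable_on UNIV \<times> UNIV"
    by (rule summable_on_comparison_test) (use norm_a in \<open>auto simp del: of_nat_Suc\<close>)
  then have summable: "(\<lambda>(k, n). a k n) summable_on UNIV \<times> UNIV"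
    by (rule abs_summable_summable)
  then obtain \<sigma> where \<sigma>: "((\<lambda>(k, n). a k n) has_sum \<sigma>) (UNIV \<times> UNIV)"
    by (auto simp: summable_on_def)
  have row_summable: "(\<lambda>n. a k n) summable_on UNIV" for k
    using summable_on_SigmaD1[OF summable, of k] by simp
  have \<sigma>': "((\<lambda>(n, k). a k n) has_sum \<sigma>) (UNIV \<times> UNIV)"
    using \<sigma> by (subst (asm) has_sum_swap) (simp add: case_prod_unfold)
  have col_summable: "(\<lambda>k. a k n) summable_on UNIV" for n
    using summable_on_SigmaD1[OF has_sum_imp_summable[OF \<sigma>'], of n] by simp
  have row: "((\<lambda>n. a k n) has_sum zeta_term q k s) UNIV" for k
  proof -
    \<comment> \<open>\<open>v\<close> is \<open>q\<close> to the power \<open>s + 2 k\<close>, and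
      \<open>(n + 1) v^n\<close> sums to \<open>1 / (1 - v)\<^sup>2\<close>, the source of the
      squared denominators. The extra \<open>(q\<^sup>2) ^ k\<close> comes from the exponent
      \<open>Suc n\<close>.\<close>
    define v where "v = u * of_real ((q\<^sup>2) ^ k)"
    have "(q\<^sup>2) ^ k \<le> 1" by (rule power_le_one) (use Q in linarith)+
    then have "cmod v \<le> cmod u * 1"
      unfolding v_def norm_mult by (intro mult_left_mono) (auto simp: norm_power)
    then have "cmod v < 1" using u by simp
    from sums_mult[OF geometric_deriv_sums[OF this], of "pochhammer s k / fact k * of_real ((q\<^sup>2) ^ k)"]
    have "(\<lambda>n. pochhammer s k / fact k * of_real ((q\<^sup>2) ^ k) * (of_nat (Suc n) * v ^ n)) sums
      (pochhammer s k / fact k * of_real ((q\<^sup>2) ^ k) * (1 / (1 - v)\<^sup>2))" .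
    moreover have "pochhammer s k / fact k * of_real ((q\<^sup>2) ^ k) * (of_nat (Suc n) * v ^ n) = a k n" for n
      by (simp add: a_def v_def power_mult_distrib mult_ac flip: power_mult del: of_nat_Suc)
    moreover have "v = of_real q powr (s + 2 * of_nat k)"
    proof -
      have "(of_real q :: complex) powr (2 * of_nat k) = of_real q ^ (2 * k)"
        using q powr_nat'[of "of_real q :: complex" "2 * k"] by simp
      then show ?thesis
        by (simp add: v_def u_def powr_add power_mult)
    qed
    ultimately have "(\<lambda>n. a k n) sums zeta_term q k s"
      by (simp add: zeta_term_def q_denom_def power_mult)
    \<comment> \<open>Unconditional summability is already known, so the ordered sum identifies its
      value.\<close>
    then show ?thesis
      using row_summable[of k] by (metis has_sum_imp_sums has_sum_infsum sums_unique2)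
  qed
  have col: "((\<lambda>k. a k n) has_sum of_nat (Suc n) * u ^ n * (1 - of_real ((q\<^sup>2) ^ Suc n)) powr (- s)) UNIV" for n
  proof -
    have "\<bar>(q\<^sup>2) ^ Suc n\<bar> < 1" using QS[of n] Q by (simp del: power_Suc)
    then have "cmod (of_real ((q\<^sup>2) ^ Suc n)) < 1" by (simp only: norm_of_real)
    from sums_mult[OF binomial_series_minus[OF this, of s], of "of_nat (Suc n) * u ^ n"]
    have "(\<lambda>k. a k n) sums (of_nat (Suc n) * u ^ n * (1 - of_real ((q\<^sup>2) ^ Suc n)) powr (- s))"
      by (simp add: a_def mult_ac del: of_nat_Suc power_Suc)
    then show ?thesis
      using col_summable[of n] by (metis has_sum_imp_sums has_sum_infsum sums_unique2)
  qed
  have "((\<lambda>k. zeta_term q k s) has_sum \<sigma>) UNIV"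
    by (rule has_sum_SigmaD[OF \<sigma>]) (use row in simp)
  then have "(\<Sum>k. zeta_term q k s) = \<sigma>"
    using has_sum_imp_sums sums_unique by blast
  moreover have "((\<lambda>n. of_nat (Suc n) * u ^ n * (1 - of_real ((q\<^sup>2) ^ Suc n)) powr (- s)) has_sum \<sigma>) UNIV"
    by (rule has_sum_SigmaD[OF \<sigma>']) (use col in simp)
  ultimately show ?thesis by (simp only: u_def)
qed

section \<open>The spectral zeta function\<close>

text \<open>Every factor of the eigenvalue is a positive real, so the complex power splits through
  real logarithms without branch corrections.\<close>

lemma eigenvalue_powr:
  fixes s w :: complex
  assumes q: "0 < q" "q < 1" and w: "w \<noteq> 0"
  shows "of_real (cmod w * qnum q (real (Suc n))) powr (- s) =
    of_real ((1 - q\<^sup>2) / cmod w) powr s *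
      ((of_real q powr s) ^ n * (1 - of_real ((q\<^sup>2) ^ Suc n)) powr (- s))"
proof -
  define c where "c = (1 - q\<^sup>2) / cmod w"
  define t where "t = 1 - (q\<^sup>2) ^ Suc n"
  have "q\<^sup>2 < 1" using q by (simp add: power_less_one_iff)
  then have c: "0 < c" using w by (simp add: c_def)
  have "(q\<^sup>2) ^ Suc n < 1"
    by (rule power_Suc_less_one) (use q \<open>q\<^sup>2 < 1\<close> in auto)
  then have t: "0 < t" by (simp add: t_def)
  have "cmod w * qnum q (real (Suc n)) = inverse c * inverse (q ^ n) * t"
  proof -
    have "qnum q (real (Suc n)) = (inverse (q ^ Suc n) - q ^ Suc n) / (inverse q - q)"
      using q unfolding qnum_def
      by (simp add: powr_minus powr_realpow del: of_nat_Suc power_Suc)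
    also have "\<dots> = inverse (q ^ n) * t / (1 - q\<^sup>2)"
      using q \<open>q\<^sup>2 < 1\<close> by (simp add: t_def field_simps power2_eq_square power_mult_distrib)
    finally show ?thesis using w by (simp add: c_def)
  qed
  moreover have "0 < inverse (q ^ n)" using q by simp
  ultimately have ln: "ln (cmod w * qnum q (real (Suc n))) = - ln c - real n * ln q + ln t"
    and pos: "0 < cmod w * qnum q (real (Suc n))"
    using c t q by (simp_all add: ln_mult ln_inverse ln_realpow)
  have powr: "complex_of_real r powr z = exp (z * of_real (ln r))" if "0 < r" for r z
    using that by (simp add: powr_def Ln_of_real)
  have "of_real (cmod w * qnum q (real (Suc n))) powr (- s) =
      exp (s * of_real (ln c) + of_nat n * (s * of_real (ln q)) + - s * of_real (ln t))"
    unfolding powr[OF pos] ln by (simp add: algebra_simps)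
  also have "\<dots> = of_real c powr s * ((of_real q powr s) ^ n * of_real t powr (- s))"
    unfolding exp_add exp_of_nat_mult powr[OF c] powr[OF t] powr[OF q(1)] by simp
  finally show ?thesis by (simp add: c_def t_def)
qed

text \<open>Defined by the series at every \<open>s\<close>; at points of \<open>Sd1\<close> the
  value is conventional and does not affect the pole.\<close>

definition podles_zeta :: "real \<Rightarrow> complex \<Rightarrow> complex \<Rightarrow> complex" where
  "podles_zeta q w s = 4 * of_real ((1 - q\<^sup>2) / cmod w) powr s * (\<Sum>n. zeta_term q n s)"

lemma has_trace_Dirac_powr:
  assumes q: "0 < q" "q < 1" and w: "w \<noteq> 0" and s: "Re s > 0"
  shows "has_trace labels2 (op_powr labels2 (modulus labels2 (Dirac q w)) (- s)) (podles_zeta q w s)"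
proof -
  define H where "H r = of_real (cmod w * qnum q r) powr (- s)" for r
  define c where "c = complex_of_real ((1 - q\<^sup>2) / cmod w) powr s"
  \<comment> \<open>This counts one summand of the Hilbert space; the second summand turns the
    factor \<open>2\<close> into the \<open>4\<close> of \<open>podles_zeta\<close>.\<close>
  have "2 * of_nat (Suc n) * H (real (Suc n)) =
      2 * c * (of_nat (Suc n) * (of_real q powr s) ^ n * (1 - of_real ((q\<^sup>2) ^ Suc n)) powr (- s))" for n
    unfolding H_def c_def eigenvalue_powr[OF q w] by (simp only: mult_ac)
  then have "((\<lambda>n. 2 * of_nat (Suc n) * H (real (Suc n))) has_sum 2 * c * (\<Sum>n. zeta_term q n s)) UNIV"
    using has_sum_cmult_right[OF has_sum_zeta_series[OF q s], of "2 * c"] by simp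
  from has_sum_labels2[OF this]
  have "((\<lambda>i. of_real (cmod w * eigenvalue q i) powr (- s)) has_sum podles_zeta q w s) labels2"
    by (simp add: H_def eigenvalue_def podles_zeta_def c_def mult.assoc)
  then show ?thesis
    unfolding modulus_Dirac[OF q w] op_powr_def functional_calculus_diag_op
    by (rule has_trace_diag_op)
qed

lemma powr_const_analytic: "c \<noteq> 0 \<Longrightarrow> (\<lambda>s::complex. c powr s) analytic_on A"
  unfolding powr_def by (auto intro!: analytic_intros)

lemma podles_zeta_prefactor_nonzero:
  assumes "0 < q" "q < 1" "w \<noteq> 0"
  shows "complex_of_real ((1 - q\<^sup>2) / cmod w) \<noteq> 0"
  unfolding of_real_eq_0_iff using assms by (simp add: power2_eq_1_iff)

lemma podles_zeta_analytic:
  assumes "0 < q" "q < 1" "w \<noteq> 0" "z \<notin> Sd1 q"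
  shows "podles_zeta q w analytic_on {z}"
  unfolding podles_zeta_def
  by (intro analytic_on_mult analytic_on_const powr_const_analytic zeta_series_analytic
      podles_zeta_prefactor_nonzero assms)

text \<open>The prefactor is entire without zeros, so it can be absorbed into the numerator
  \<open>g\<close> without changing the pole order.\<close>

lemma podles_zeta_double_pole:
  assumes "0 < q" "q < 1" "w \<noteq> 0" "z \<in> Sd1 q"
  shows "is_pole (podles_zeta q w) z" "zorder (podles_zeta q w) z = - 2"
    "podles_zeta q w meromorphic_on {z}"
proof -
  note c = podles_zeta_prefactor_nonzero[OF assms(1-3)]
  obtain g where g: "g analytic_on {z}" "g z \<noteq> 0"
    "\<And>s. s \<noteq> z \<Longrightarrow> (\<Sum>n. zeta_term q n s) = g s / (s - z)\<^sup>2"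
    using zeta_series_numerator[OF assms(1,2,4)] by blast
  have an: "(\<lambda>s. 4 * of_real ((1 - q\<^sup>2) / cmod w) powr s * g s) analytic_on {z}"
    by (intro analytic_on_mult analytic_on_const powr_const_analytic g c)
  have nz: "4 * of_real ((1 - q\<^sup>2) / cmod w) powr z * g z \<noteq> 0"
    using g(2) c by simp
  have eq: "podles_zeta q w s = 4 * of_real ((1 - q\<^sup>2) / cmod w) powr s * g s / (s - z)\<^sup>2"
    if "s \<noteq> z" for s
    using g(3)[OF that] by (simp add: podles_zeta_def)
  from double_pole[OF an nz eq] show "is_pole (podles_zeta q w) z"
    "zorder (podles_zeta q w) z = - 2" "podles_zeta q w meromorphic_on {z}"
    by simp_all
qed

theorem proposition3p2:
  fixes q :: real and w :: complex
  assumes "0 < q" and "q < 1" and "w \<noteq> 0"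
  shows "\<exists>\<zeta> :: complex \<Rightarrow> complex.
      (\<forall>s. Re s > 0 \<longrightarrow>
         has_trace labels2 (op_powr labels2 (modulus labels2 (Dirac q w)) (- s)) (\<zeta> s)) \<and>
      \<zeta> meromorphic_on UNIV \<and>
      \<zeta> holomorphic_on (- Sd1 q) \<and>
      (\<forall>s. s \<notin> Sd1 q \<longrightarrow>
         summable (\<lambda>n. pochhammer s n / fact n *
           (of_real q ^ (2 * n) / (1 - of_real q powr (s + 2 * of_nat n))\<^sup>2)) \<and>
         \<zeta> s = 4 * of_real ((1 - q\<^sup>2) / cmod w) powr s *
           (\<Sum>n. pochhammer s n / fact n *
             (of_real q ^ (2 * n) / (1 - of_real q powr (s + 2 * of_nat n))\<^sup>2))) \<and>
      {s. is_pole \<zeta> s} = Sd1 q \<and>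
      (\<forall>s. is_pole \<zeta> s \<longrightarrow> zorder \<zeta> s = - 2) \<and>
      infinite (Sd1 q) \<and> countable (Sd1 q)"
proof (intro exI[of _ "podles_zeta q w"] conjI allI impI)
  note analytic = podles_zeta_analytic[OF assms]
  note double_pole = podles_zeta_double_pole[OF assms]
  show "has_trace labels2 (op_powr labels2 (modulus labels2 (Dirac q w)) (- s)) (podles_zeta q w s)"
    if "Re s > 0" for s
    using has_trace_Dirac_powr[OF assms that] .
  \<comment> \<open>Meromorphy is local, and each point is either a point of analyticity or a double
    pole.\<close>
  show "podles_zeta q w meromorphic_on UNIV"
    unfolding meromorphic_on_meromorphic_at[of _ UNIV]
    using analytic double_pole(3) analytic_on_imp_meromorphic_on by blast
  have "podles_zeta q w analytic_on - Sd1 q"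
    using analytic analytic_on_analytic_at by blast
  then show "podles_zeta q w holomorphic_on - Sd1 q"
    by (rule analytic_imp_holomorphic)
  have pole_iff: "is_pole (podles_zeta q w) s \<longleftrightarrow> s \<in> Sd1 q" for s
    using analytic double_pole(1) analytic_at_imp_no_pole by blast
  then show "{s. is_pole (podles_zeta q w) s} = Sd1 q" by auto
  show "zorder (podles_zeta q w) s = - 2" if "is_pole (podles_zeta q w) s" for s
    using that pole_iff double_pole(2) by blast
  show "summable (\<lambda>n. pochhammer s n / fact n *
      (of_real q ^ (2 * n) / (1 - of_real q powr (s + 2 * of_nat n))\<^sup>2))" for s :: complex
    using zeta_term_summable[OF assms(1,2), of s] by (simp add: zeta_term_def q_denom_def)
  show "podles_zeta q w s = 4 * of_real ((1 - q\<^sup>2) / cmod w) powr s *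
      (\<Sum>n. pochhammer s n / fact n *
        (of_real q ^ (2 * n) / (1 - of_real q powr (s + 2 * of_nat n))\<^sup>2))" for s :: complex
    by (simp add: podles_zeta_def zeta_term_def q_denom_def)
qed (use Sd1_infinite_countable[OF assms(1,2)] in auto)

end
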